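(* Let $P$ be a program (possibly containing nested loops), and let $P^{(u)}$ be its $u$-fold unrolling. Suppose $\mathrm{EGD}(\mathbf{P},\boldsymbol\alpha)\mathrel{[\![P]\!]^{\mathsf{geo}}}\mathrm{EGD}(\mathbf{Q},\boldsymbol\beta)$. Then there exist $A\in\mathbb{R}_{\ge0}$, $C\in[0,1)$ and tensors $\mathbf{Q}^{(u)}$ ($u\in\mathbb{N}$) such that for every $u\in\mathbb{N}$ $$\mathrm{EGD}(\mathbf{P},\boldsymbol\alpha)\mathrel{[\![P^{(u)}]\!]^{\mathsf{geo}}}\mathrm{EGD}(\mathbf{Q}^{(u)},\boldsymbol\beta),\qquad\mathrm{EGD}(\mathbf{Q}^{(u)},\boldsymbol\beta)\preceq_{\mathsf{EGD}}\mathrm{EGD}(\mathbf{Q},\boldsymbol\beta),$$ and $$\mathrm{EGD}(\mathbf{Q}^{(u)},\boldsymbol\beta)-[\![P]\!](\mathrm{EGD}(\mathbf{P},\boldsymbol\alpha))\preceq A\cdot C^u\cdot\mathrm{EGD}(\mathbf{Q},\boldsymbol\beta).$$ In particular, $\mathrm{EGD}(\mathbf{Q}^{(u)},\boldsymbol\beta)$ converges in total variation distance to $[\![P]\!](\mathrm{EGD}(\mathbf{P},\boldsymbol\alpha))$ as $u\to\infty$, and for every $k\in\mathbb{N}$ and every variable index $i$, the $k$-th moment $\mathbb{E}_{\boldsymbol X\sim\mathrm{EGD}(\mathbf{Q}^{(u)},\boldsymbol\beta)}[X_i^k]$ converges to $\mathbb{E}_{\boldsymbol X\sim[\![P]\!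](\mathrm{EGD}(\mathbf{P},\boldsymbol\alpha))}[X_i^k]$.
   Context: Language. Fix $n$ variables $X_1,\dots,X_n$ with values in $\mathbb{N}=\{0,1,2,\dots\}$. Programs $P$ and events $E$ are given by $P ::= \mathsf{skip} \mid P_1;P_2 \mid X_k := 0 \mid X_k \mathrel{+}= a \mid X_k \mathrel{\dot-}= 1 \mid \mathsf{if}\ E\ \{P_1\}\ \mathsf{else}\ \{P_2\} \mid \mathsf{while}\ E\ \{P_1\} \mid \mathsf{fail}$ and $E ::= X_k = a \mid \mathsf{flip}(\rho) \mid \lnot E_1 \mid E_1 \land E_2$, with literals $a \in \mathbb{N}$, $\rho \in [0,1]$. State space. $\mathbb{N}^n_\dagger := \mathbb{N}^n \cup \{\dagger\}$ where $\dagger$ is a failure state; all $\sigma$-algebras are discrete. For (possibly signed differences of) measures, $\mu \preceq \nu$ means $\mu(S)\le\nu(S)$ for all $S$; for measure transformers, $\phi \sqsubseteq \psi$ means $\phi(\mu)\preceq\psi(\mu)$ for all $\mu$. Write $\mu|_\dagger$ and $\mu|_{\mathbb{N}^n}$ for the restrictions of $\mu$ to $\{\dagger\}$ and $\mathbb{N}^n$; $\boldsymbol{x}[k\mapsto v]$ is $\boldsymbol{x}$ with $k$-th entry replaced by $v$; $x \mathbin{\dot-} 1 := \max(x-1,0)$. Measures on $\mathbb{N}^n$ are regarded as measures on $\mathbb{N}^n_\dagger$ with no mass on $\dagger$. For a measure $\mu$ on $\mathbb{N}^n$ (not necessarily a probability), $\mathbb{E}_{\boldsymbol X\sim\mu}[f(\boldsymbol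 X)]:=\sum_{\boldsymbol x}\mu(\boldsymbol x)f(\boldsymbol x)$. Event semantics. $\mu|_{X_k=a}(S) := \mu(\{\boldsymbol{x}\in S\cap\mathbb{N}^n : x_k=a\})$, $\mu|_{\mathsf{flip}(\rho)} := \rho\cdot\mu|_{\mathbb{N}^n}$, $\mu|_{\lnot E_1} := \mu|_{\mathbb{N}^n}-\mu|_{E_1}$, $\mu|_{E_1\land E_2} := (\mu|_{E_1})|_{E_2}$. Standard semantics $[\![P]\!]_\dagger : \mathrm{Meas}(\mathbb{N}^n_\dagger)\to\mathrm{Meas}(\mathbb{N}^n_\dagger)$: $[\![\mathsf{skip}]\!]_\dagger(\mu)=\mu$; $[\![P_1;P_2]\!]_\dagger(\mu)=[\![P_2]\!]_\dagger([\![P_1]\!]_\dagger(\mu))$; $[\![X_k:=0]\!]_\dagger(\mu)(S)=\mu|_\dagger(S)+\mu(\{\boldsymbol{x}\in\mathbb{N}^n : \boldsymbol{x}[k\mapsto 0]\in S\})$; $[\![X_k \mathrel{+}= a]\!]_\dagger(\mu)(S)=\mu|_\dagger(S)+\mu(\{\boldsymbol{x}\in\mathbb{N}^n : \boldsymbol{x}[k\mapsto x_k+a]\in S\})$; $[\![X_k \mathrel{\dot-}= 1]\!]_\dagger(\mu)(S)=\mu|_\dagger(S)+\mu(\{\boldsymbol{x}\in\mathbb{N}^n : \boldsymbol{x}[k\mapsto x_k\mathbin{\dot-}1]\in S\})$; $[\![\mathsf{if}\ E\ \{P_1\}\ \mathsf{else}\ \{P_2\}]\!]_\dagger(\mu)=\mu|_\dagger+[\![P_1]\!]_\dagger(\mu|_E)+[\![P_2]\!]_\dagger(\mu|_{\lnot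 E})$; $[\![\mathsf{fail}]\!]_\dagger(\mu)=\mu(\mathbb{N}^n_\dagger)\cdot\mathrm{Dirac}(\dagger)$; $[\![\mathsf{while}\ E\ \{P_1\}]\!]_\dagger$ is the least fixed point (w.r.t. $\sqsubseteq$) of $\Phi_{E,P_1}(\psi)(\mu) := \mu|_\dagger+\mu|_{\lnot E}+\psi([\![P_1]\!]_\dagger(\mu|_E))$. Simplified semantics: $[\![P]\!](\mu) := [\![P]\!]_\dagger(\mu)|_{\mathbb{N}^n}$ for $\mu\in\mathrm{Meas}(\mathbb{N}^n)$. Unrolling. For $u\in\mathbb{N}$: $(P_1;P_2)^{(u)} := P_1^{(u)};P_2^{(u)}$; $(\mathsf{if}\ E\ \{P_1\}\ \mathsf{else}\ \{P_2\})^{(u)} := \mathsf{if}\ E\ \{P_1^{(u)}\}\ \mathsf{else}\ \{P_2^{(u)}\}$; $(\mathsf{while}\ E\ \{P\})^{(u)} := (\mathsf{while}\ E\ \{P\})^{(u)}_0$, where $(\mathsf{while}\ E\ \{P\})^{(u)}_v := \mathsf{if}\ E\ \{P^{(u)};(\mathsf{while}\ E\ \{P\})^{(u)}_{v+1}\}\ \mathsf{else}\ \{\mathsf{skip}\}$ for $v<u$ and $(\mathsf{while}\ E\ \{P\})^{(u)}_u := \mathsf{while}\ E\ \{P^{(u)}\}$; and $P^{(u)} := P$ for all other programs. Tensors and EGDs. $[d] := \{0,\dots,d-1\}$. A tensor $\mathbf{T}\in\mathbb{R}^{[d_1]\times\cdots\times[d_n]}$ (all $d_i\ge1$) has size $|\mathbf{T}|=(d_1,\dots,d_n)$,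 $|\mathbf{T}|_i=d_i$; $\mathbf{T}_{k:j}$ is the slice with $k$-th index fixed to $j$. Operations $\min,\max,+,-$ and relations $\le,<$ on vectors are componentwise; $\mathbf{0}_n,\mathbf{1}_n$ are the constant vectors; $\boldsymbol\alpha^{\boldsymbol i} := \prod_k\alpha_k^{i_k}$ with $0^0=1$; $[\varphi]$ is $1$ if $\varphi$ holds and $0$ otherwise. For a nonnegative tensor $\mathbf{P}$ and $\boldsymbol\alpha\in[0,1)^n$, $\mathrm{EGD}(\mathbf{P},\boldsymbol\alpha)$ is the measure on $\mathbb{N}^n$ with mass function $\boldsymbol i\mapsto\mathbf{P}_{\min(\boldsymbol i,|\mathbf{P}|-\mathbf{1}_n)}\cdot\boldsymbol\alpha^{\max(\boldsymbol i-|\mathbf{P}|+\mathbf{1}_n,\mathbf{0}_n)}$. An expansion of $\mathrm{EGD}(\mathbf{P},\boldsymbol\alpha)$ to a size $\boldsymbol s\ge|\mathbf{P}|$ is $\mathrm{EGD}(\mathbf{P}',\boldsymbol\alpha)$ with $|\mathbf{P}'|=\boldsymbol s$ and $\mathbf{P}'_{\boldsymbol i}=\mathbf{P}_{\min(\boldsymbol i,|\mathbf{P}|-\mathbf{1}_n)}\boldsymbol\alpha^{\max(\boldsymbol i-|\mathbf{P}|+\mathbf{1}_n,\mathbf{0}_n)}$ for $\boldsymbol i<\boldsymbol s$. The relations and operations below act on representations $(\mathbf{P},\boldsymbol\alpha)$, although written with $\mathrm{EGD}(\mathbf{P},\boldsymbol\alpha)$. Order: $\mathrm{EGD}(\mathbf{P},\boldsymbol\alpha)\preceq_{\mathsf{EGD}}\mathrm{EGD}(\mathbf{Q},\boldsymbol\beta)$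 iff $\boldsymbol\alpha\le\boldsymbol\beta$ and for all $\boldsymbol i<\max(|\mathbf{P}|,|\mathbf{Q}|)$: $\mathbf{P}_{\min(\boldsymbol i,|\mathbf{P}|-\mathbf{1}_n)}\boldsymbol\alpha^{\max(\boldsymbol i-|\mathbf{P}|+\mathbf{1}_n,\mathbf{0}_n)}\le\mathbf{Q}_{\min(\boldsymbol i,|\mathbf{Q}|-\mathbf{1}_n)}\boldsymbol\beta^{\max(\boldsymbol i-|\mathbf{Q}|+\mathbf{1}_n,\mathbf{0}_n)}$. Join: $(\mathrm{EGD}(\mathbf{R},\boldsymbol\gamma),\mathrm{EGD}(\mathbf{S},\boldsymbol\delta),\mathrm{EGD}(\mathbf{Q},\boldsymbol\beta))\in\mathsf{Join}$ iff $\boldsymbol\gamma\le\boldsymbol\beta$, $\boldsymbol\delta\le\boldsymbol\beta$ and there are expansions $\mathrm{EGD}(\mathbf{R}',\boldsymbol\gamma)$, $\mathrm{EGD}(\mathbf{S}',\boldsymbol\delta)$ of the first two, of the same size, with $\mathbf{Q}=\mathbf{R}'+\mathbf{S}'$. Geometric event semantics $\mathrm{EGD}(\mathbf{P},\boldsymbol\alpha)|^{\mathsf{geo}}_E$: for $X_k=a$: $\mathrm{EGD}(\mathbf{Q},\boldsymbol\alpha[k\mapsto0])$ with $|\mathbf{Q}|=|\mathbf{P}|[k\mapsto\max(|\mathbf{P}|_k,a+2)]$, $\mathbf{Q}_{k:j}=\mathbf{P}_{k:\min(j,|\mathbf{P}|_k-1)}\cdot\alpha_k^{\max(0,j-|\mathbf{P}|_k+1)}\cdot[j=a]$;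 for $\mathsf{flip}(\rho)$: $\mathrm{EGD}(\rho\mathbf{P},\boldsymbol\alpha)$; for $\lnot E_1$: $\mathrm{EGD}(\mathbf{Q},\boldsymbol\alpha)$ where $\mathrm{EGD}(\mathbf{P},\boldsymbol\alpha)|^{\mathsf{geo}}_{E_1}=\mathrm{EGD}(\mathbf{R},\boldsymbol\gamma)$, $|\mathbf{Q}|=|\mathbf{R}|$, $\mathbf{Q}_{\boldsymbol i}=\mathbf{P}_{\min(\boldsymbol i,|\mathbf{P}|-\mathbf{1}_n)}\boldsymbol\alpha^{\max(\boldsymbol i-|\mathbf{P}|+\mathbf{1}_n,\mathbf{0}_n)}-\mathbf{R}_{\boldsymbol i}$ for $\boldsymbol i<|\mathbf{Q}|$; for $E_1\land E_2$: $(\mathrm{EGD}(\mathbf{P},\boldsymbol\alpha)|^{\mathsf{geo}}_{E_1})|^{\mathsf{geo}}_{E_2}$. Geometric bound semantics: the relation $\mathrm{EGD}(\mathbf{P},\boldsymbol\alpha)\mathrel{[\![P]\!]^{\mathsf{geo}}}\mathrm{EGD}(\mathbf{Q},\boldsymbol\beta)$ holds iff: - $\mathsf{skip}$: $\boldsymbol\beta=\boldsymbol\alpha$, $\mathbf{Q}=\mathbf{P}$. - $P_1;P_2$: there are $\mathbf{R},\boldsymbol\gamma$ with $\mathrm{EGD}(\mathbf{P},\boldsymbol\alpha)\mathrel{[\![P_1]\!]^{\mathsf{geo}}}\mathrm{EGD}(\mathbf{R},\boldsymbol\gamma)$ and $\mathrm{EGD}(\mathbf{R},\boldsymbol\gamma)\mathrel{[\![P_2]\!]^{\mathsf{geo}}}\mathrm{EGD}(\mathbf{Q},\boldsymbol\beta)$.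 - $X_k:=0$: $\boldsymbol\beta=\boldsymbol\alpha[k\mapsto0]$, $|\mathbf{Q}|=|\mathbf{P}|[k\mapsto2]$, $\mathbf{Q}_{k:0}=\frac{\mathbf{P}_{k:|\mathbf{P}|_k-1}}{1-\alpha_k}+\sum_{j=0}^{|\mathbf{P}|_k-2}\mathbf{P}_{k:j}$, $\mathbf{Q}_{k:1}=0$. - $X_k\mathrel{+}=a$: $\boldsymbol\beta=\boldsymbol\alpha$, $|\mathbf{Q}|=|\mathbf{P}|[k\mapsto|\mathbf{P}|_k+a]$, $\mathbf{Q}_{k:j}=0$ for $j<a$ and $\mathbf{Q}_{k:j}=\mathbf{P}_{k:j-a}$ otherwise. - $X_k\mathrel{\dot-}=1$: $\boldsymbol\beta=\boldsymbol\alpha$, $|\mathbf{Q}|=|\mathbf{P}|[k\mapsto\max(|\mathbf{P}|_k-1,2)]$, $\mathbf{Q}_{k:0}=\mathbf{P}_{k:0}+\mathbf{P}_{k:\min(|\mathbf{P}|_k-1,1)}\alpha_k^{\max(2-|\mathbf{P}|_k,0)}$ and $\mathbf{Q}_{k:j}=\mathbf{P}_{k:\min(|\mathbf{P}|_k-1,j+1)}\alpha_k^{\max(j+2-|\mathbf{P}|_k,0)}$ for $j\ge1$. - $\mathsf{if}\ E\ \{P_1\}\ \mathsf{else}\ \{P_2\}$: there are $\mathbf{R},\mathbf{S},\boldsymbol\gamma,\boldsymbol\delta$ with $\mathrm{EGD}(\mathbf{P},\boldsymbol\alpha)|^{\mathsf{geo}}_E\mathrel{[\![P_1]\!]^{\mathsf{geo}}}\mathrm{EGD}(\mathbf{R},\boldsymbol\gamma)$,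 $\mathrm{EGD}(\mathbf{P},\boldsymbol\alpha)|^{\mathsf{geo}}_{\lnot E}\mathrel{[\![P_2]\!]^{\mathsf{geo}}}\mathrm{EGD}(\mathbf{S},\boldsymbol\delta)$ and $(\mathrm{EGD}(\mathbf{R},\boldsymbol\gamma),\mathrm{EGD}(\mathbf{S},\boldsymbol\delta),\mathrm{EGD}(\mathbf{Q},\boldsymbol\beta))\in\mathsf{Join}$. - $\mathsf{while}\ E\ \{B\}$: there are $c\in[0,1)$, $\mathbf{R},\mathbf{S},\boldsymbol\gamma,\boldsymbol\delta$ with $\mathrm{EGD}(\mathbf{P},\boldsymbol\alpha)\preceq_{\mathsf{EGD}}\mathrm{EGD}(\mathbf{R},\boldsymbol\gamma)$, $\mathrm{EGD}(\mathbf{R},\boldsymbol\gamma)|^{\mathsf{geo}}_E\mathrel{[\![B]\!]^{\mathsf{geo}}}\mathrm{EGD}(\mathbf{S},\boldsymbol\delta)$, $\mathrm{EGD}(\mathbf{S},\boldsymbol\delta)\preceq_{\mathsf{EGD}}\mathrm{EGD}(c\,\mathbf{R},\boldsymbol\gamma)$ and $\mathrm{EGD}(\frac{\mathbf{R}}{1-c},\boldsymbol\gamma)|^{\mathsf{geo}}_{\lnot E}=\mathrm{EGD}(\mathbf{Q},\boldsymbol\beta)$. - $\mathsf{fail}$: $\boldsymbol\beta=\mathbf{0}_n$, $\mathbf{Q}$ is the zero tensor of size $(1,\dots,1)$. *)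

theory Defs
  imports "HOL-Analysis.Analysis"
begin

section \<open>Programs\<close>

text \<open>
  The variables are indexed by a finite type \<open>'n\<close>, so that \<open>'n \<Rightarrow> nat\<close> is the set of
  \<open>n\<close>-tuples of natural numbers for \<open>n = CARD('n)\<close>.
\<close>

datatype 'n event =
    VarEq 'n nat
  | Flip real
  | ENot "'n event"
  | EAnd "'n event" "'n event"

datatype 'n prog =
    Skip
  | Seq "'n prog" "'n prog"
  | SetZero 'n
  | Incr 'n nat
  | Decr 'n
  | IfElse "'n event" "'n prog" "'n prog"
  | While "'n event" "'n prog"
  | Fail

primrec wf_event :: "'n event \<Rightarrow> bool" where
  "wf_event (VarEq k a) \<longleftrightarrow> True"
| "wf_event (Flip \<rho>) \<longleftrightarrow> 0 \<le> \<rho> \<and> \<rho> \<le> 1"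
| "wf_event (ENot E) \<longleftrightarrow> wf_event E"
| "wf_event (EAnd E1 E2) \<longleftrightarrow> wf_event E1 \<and> wf_event E2"

primrec wf_prog :: "'n prog \<Rightarrow> bool" where
  "wf_prog Skip \<longleftrightarrow> True"
| "wf_prog (Seq P1 P2) \<longleftrightarrow> wf_prog P1 \<and> wf_prog P2"
| "wf_prog (SetZero k) \<longleftrightarrow> True"
| "wf_prog (Incr k a) \<longleftrightarrow> True"
| "wf_prog (Decr k) \<longleftrightarrow> True"
| "wf_prog (IfElse E P1 P2) \<longleftrightarrow> wf_event E \<and> wf_prog P1 \<and> wf_prog P2"
| "wf_prog (While E B) \<longleftrightarrow> wf_event E \<and> wf_prog B"
| "wf_prog Fail \<longleftrightarrow> True"

function unroll_loop :: "'n event \<Rightarrow> 'n prog \<Rightarrow> nat \<Rightarrow> nat \<Rightarrow> 'n prog" where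
  "unroll_loop E B u v =
     (if v < u then IfElse E (Seq B (unroll_loop E B u (v + 1))) Skip else While E B)"
  by auto
termination by (relation "Wellfounded.measure (\<lambda>(E, B, u, v). u - v)") auto

declare unroll_loop.simps [simp del]

primrec unroll :: "nat \<Rightarrow> 'n prog \<Rightarrow> 'n prog" where
  "unroll u Skip = Skip"
| "unroll u (Seq P1 P2) = Seq (unroll u P1) (unroll u P2)"
| "unroll u (SetZero k) = SetZero k"
| "unroll u (Incr k a) = Incr k a"
| "unroll u (Decr k) = Decr k"
| "unroll u (IfElse E P1 P2) = IfElse E (unroll u P1) (unroll u P2)"
| "unroll u (While E B) = unroll_loop E (unroll u B) u 0"
| "unroll u Fail = Fail"

section \<open>Standard semantics\<close>

type_synonym 'n state = "'n \<Rightarrow> nat"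

text \<open>
  A state of the standard semantics is \<open>Some x\<close> for a valuation \<open>x\<close>, or \<open>None\<close> for the
  failure state. All measures carry the discrete sigma-algebra, on which the library order on
  measures is the setwise order \<open>\<forall>S. emeasure M S \<le> emeasure N S\<close>.
\<close>

definition discrete_measure :: "('a set \<Rightarrow> ennreal) \<Rightarrow> 'a measure" where
  "discrete_measure f = measure_of UNIV UNIV f"

definition plus_m :: "'a measure \<Rightarrow> 'a measure \<Rightarrow> 'a measure" (infixl "\<oplus>\<^sub>m" 65) where
  "M \<oplus>\<^sub>m N = discrete_measure (\<lambda>S. emeasure M S + emeasure N S)"

definition restr_fail :: "'a option measure \<Rightarrow> 'a option measure" where
  "restr_fail \<mu> = discrete_measure (\<lambda>S. emeasure \<mu> (S \<inter> {None}))"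

definition restr_ok :: "'a option measure \<Rightarrow> 'a option measure" where
  "restr_ok \<mu> = discrete_measure (\<lambda>S. emeasure \<mu> (S \<inter> range Some))"

text \<open>
  The difference of measures in the case \<open>ENot\<close> is meaningful only where the masses are finite.
  For a set of infinite mass the value is the convention \<open>\<infinity> - \<infinity> = \<infinity>\<close> of \<open>ennreal\<close>;
  the semantics of a program at a finite measure never involves an infinite one.
\<close>

primrec restr :: "'n event \<Rightarrow> 'n state option measure \<Rightarrow> 'n state option measure" where
  "restr (VarEq k a) \<mu> = discrete_measure (\<lambda>S. emeasure \<mu> {Some x |x. Some x \<in> S \<and> x k = a})"
| "restr (Flip \<rho>) \<mu> = scale_measure (ennreal \<rho>) (restr_ok \<mu>)"
| "restr (ENot E) \<mu> = discrete_measure (\<lambda>S. emeasure (restr_ok \<mu>) S - emeasure (restr E \<mu>) S)"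
| "restr (EAnd E1 E2) \<mu> = restr E2 (restr E1 \<mu>)"

definition update :: "('n state \<Rightarrow> 'n state) \<Rightarrow> 'n state option measure \<Rightarrow> 'n state option measure" where
  "update f \<mu> =
     discrete_measure (\<lambda>S. emeasure (restr_fail \<mu>) S + emeasure \<mu> {Some x |x. Some (f x) \<in> S})"

text \<open>
  The least fixed point in the case \<open>While\<close> is taken with respect to the pointwise order of
  measure transformers. Every fixed point takes only discrete measures as values, because sums
  \<open>\<oplus>\<^sub>m\<close> are discrete measures, so on fixed points this order is the setwise one at each argument.
\<close>

primrec sem_full :: "'n prog \<Rightarrow> 'n state option measure \<Rightarrow> 'n state option measure" where
  "sem_full Skip = (\<lambda>\<mu>. \<mu>)"
| "sem_full (Seq P1 P2) = (\<lambda>\<mu>. sem_full P2 (sem_full P1 \<mu>))"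
| "sem_full (SetZero k) = update (\<lambda>x. x(k := 0))"
| "sem_full (Incr k a) = update (\<lambda>x. x(k := x k + a))"
| "sem_full (Decr k) = update (\<lambda>x. x(k := x k - 1))"
| "sem_full (IfElse E P1 P2) =
     (\<lambda>\<mu>. restr_fail \<mu> \<oplus>\<^sub>m sem_full P1 (restr E \<mu>) \<oplus>\<^sub>m sem_full P2 (restr (ENot E) \<mu>))"
| "sem_full (While E B) =
     (LEAST \<psi>. \<psi> = (\<lambda>\<mu>. restr_fail \<mu> \<oplus>\<^sub>m restr (ENot E) \<mu> \<oplus>\<^sub>m \<psi> (sem_full B (restr E \<mu>))))"
| "sem_full Fail = (\<lambda>\<mu>. discrete_measure (\<lambda>S. emeasure \<mu> UNIV * indicator S None))"

definition sem :: "'n prog \<Rightarrow> 'n state measure \<Rightarrow> 'n state measure" where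
  "sem P \<mu> =
     discrete_measure (\<lambda>S. emeasure (sem_full P (distr \<mu> (count_space UNIV) Some)) (Some ` S))"

text \<open>The expectation is not normalised: \<open>\<mu>\<close> need not be a probability measure.\<close>

definition expect :: "'a measure \<Rightarrow> ('a \<Rightarrow> real) \<Rightarrow> real" where
  "expect \<mu> f = (\<Sum>\<^sub>\<infinity>x. measure \<mu> {x} * f x)"

definition tv_dist :: "'a measure \<Rightarrow> 'a measure \<Rightarrow> real" where
  "tv_dist \<mu> \<nu> = (SUP S. \<bar>measure \<mu> S - measure \<nu> S\<bar>)"

section \<open>Tensors and eventually geometric distributions\<close>

text \<open>
  A tensor is a size vector with positive entries together with its entries; the entries are \<open>0\<close>
  outside the index range, so that equality of tensors is equality of sizes and of entries in
  range. The strict order on functions is not the componentwise one, hence the explicit \<open>\<forall>k\<close>.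
\<close>

typedef 'n tensor =
  "{(s, f). (\<forall>k. 1 \<le> s k) \<and> (\<forall>i. \<not> (\<forall>k. i k < s k) \<longrightarrow> f i = 0)} ::
     (('n \<Rightarrow> nat) \<times> (('n \<Rightarrow> nat) \<Rightarrow> real)) set"
  by (rule exI[of _ "(\<lambda>_. 1, \<lambda>_. 0)"]) simp

setup_lifting type_definition_tensor

lift_definition tsize :: "'n tensor \<Rightarrow> ('n \<Rightarrow> nat)" is fst .

lift_definition entry :: "'n tensor \<Rightarrow> ('n \<Rightarrow> nat) \<Rightarrow> real" is snd .

text \<open>The tensor of size \<open>s\<close> (which has to be positive) with entries \<open>f i\<close> in range.\<close>

lift_definition tensor :: "('n \<Rightarrow> nat) \<Rightarrow> (('n \<Rightarrow> nat) \<Rightarrow> real) \<Rightarrow> 'n tensor" is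
  "\<lambda>s f. (\<lambda>k. max 1 (s k), \<lambda>i. if \<forall>k. i k < max 1 (s k) then f i else 0)"
  by auto

definition tscale :: "real \<Rightarrow> 'n tensor \<Rightarrow> 'n tensor" where
  "tscale c P = tensor (tsize P) (\<lambda>i. c * entry P i)"

text \<open>A pair \<open>(P, \<alpha>)\<close> represents an eventually geometric distribution.\<close>

type_synonym 'n egd = "'n tensor \<times> ('n \<Rightarrow> real)"

definition is_egd :: "'n egd \<Rightarrow> bool" where
  "is_egd = (\<lambda>(P, \<alpha>). (\<forall>i. 0 \<le> entry P i) \<and> (\<forall>k. 0 \<le> \<alpha> k \<and> \<alpha> k < 1))"

text \<open>
  The exponent \<open>i k + 1 - tsize P k\<close> is the truncated difference
  \<open>max (i k - tsize P k + 1) 0\<close>; similarly below.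
\<close>

definition egd_mass :: "'n::finite egd \<Rightarrow> 'n state \<Rightarrow> real" where
  "egd_mass = (\<lambda>(P, \<alpha>) i.
     entry P (\<lambda>k. min (i k) (tsize P k - 1)) * (\<Prod>k\<in>UNIV. \<alpha> k ^ (i k + 1 - tsize P k)))"

definition EGD :: "'n::finite egd \<Rightarrow> 'n state measure" where
  "EGD D = density (count_space UNIV) (\<lambda>i. ennreal (egd_mass D i))"

definition egd_le :: "'n::finite egd \<Rightarrow> 'n egd \<Rightarrow> bool" (infix "\<preceq>\<^sub>E" 50) where
  "D \<preceq>\<^sub>E D' \<longleftrightarrow>
     (\<forall>k. snd D k \<le> snd D' k) \<and>
     (\<forall>i. (\<forall>k. i k < max (tsize (fst D) k) (tsize (fst D') k)) \<longrightarrow> egd_mass D i \<le> egd_mass D' i)"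

definition is_expansion :: "'n::finite egd \<Rightarrow> 'n tensor \<Rightarrow> bool" where
  "is_expansion D P' \<longleftrightarrow>
     (\<forall>k. tsize (fst D) k \<le> tsize P' k) \<and>
     (\<forall>i. (\<forall>k. i k < tsize P' k) \<longrightarrow> entry P' i = egd_mass D i)"

definition Join :: "('n::finite egd \<times> 'n egd \<times> 'n egd) set" where
  "Join = {((R, \<gamma>), (S, \<delta>), (Q, \<beta>)) | R \<gamma> S \<delta> Q \<beta>.
     (\<forall>k. \<gamma> k \<le> \<beta> k) \<and> (\<forall>k. \<delta> k \<le> \<beta> k) \<and>
     (\<exists>R' S'. is_expansion (R, \<gamma>) R' \<and> is_expansion (S, \<delta>) S' \<and> tsize R' = tsize S' \<and>
        Q = tensor (tsize R') (\<lambda>i. entry R' i + entry S' i))}"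

section \<open>Geometric bound semantics\<close>

fun geo_restr :: "'n::finite event \<Rightarrow> 'n egd \<Rightarrow> 'n egd" where
  "geo_restr (VarEq k a) (P, \<alpha>) =
     (tensor ((tsize P)(k := max (tsize P k) (a + 2)))
        (\<lambda>i. entry P (i(k := min (i k) (tsize P k - 1))) * \<alpha> k ^ (i k + 1 - tsize P k)
             * of_bool (i k = a)),
      \<alpha>(k := 0))"
| "geo_restr (Flip \<rho>) (P, \<alpha>) = (tscale \<rho> P, \<alpha>)"
| "geo_restr (ENot E) (P, \<alpha>) =
     (let R = fst (geo_restr E (P, \<alpha>))
      in (tensor (tsize R) (\<lambda>i. egd_mass (P, \<alpha>) i - entry R i), \<alpha>))"
| "geo_restr (EAnd E1 E2) (P, \<alpha>) = geo_restr E2 (geo_restr E1 (P, \<alpha>))"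

text \<open>
  \<open>EGD(P, \<alpha>)\<close> is defined for nonnegative \<open>P\<close> and \<open>\<alpha>\<close> in \<open>[0,1)\<close> only; accordingly all
  existentially quantified representations are required to satisfy \<open>is_egd\<close>.
\<close>

fun geo :: "'n::finite prog \<Rightarrow> 'n egd \<Rightarrow> 'n egd \<Rightarrow> bool" where
  "geo Skip (P, \<alpha>) (Q, \<beta>) \<longleftrightarrow> \<beta> = \<alpha> \<and> Q = P"
| "geo (Seq P1 P2) (P, \<alpha>) (Q, \<beta>) \<longleftrightarrow>
     (\<exists>R \<gamma>. is_egd (R, \<gamma>) \<and> geo P1 (P, \<alpha>) (R, \<gamma>) \<and> geo P2 (R, \<gamma>) (Q, \<beta>))"
| "geo (SetZero k) (P, \<alpha>) (Q, \<beta>) \<longleftrightarrow>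
     \<beta> = \<alpha>(k := 0) \<and>
     Q = tensor ((tsize P)(k := 2))
       (\<lambda>i. if i k = 0
            then entry P (i(k := tsize P k - 1)) / (1 - \<alpha> k)
                 + (\<Sum>j<tsize P k - 1. entry P (i(k := j)))
            else 0)"
| "geo (Incr k a) (P, \<alpha>) (Q, \<beta>) \<longleftrightarrow>
     \<beta> = \<alpha> \<and>
     Q = tensor ((tsize P)(k := tsize P k + a))
       (\<lambda>i. if i k < a then 0 else entry P (i(k := i k - a)))"
| "geo (Decr k) (P, \<alpha>) (Q, \<beta>) \<longleftrightarrow>
     \<beta> = \<alpha> \<and>
     Q = tensor ((tsize P)(k := max (tsize P k - 1) 2))
       (\<lambda>i. if i k = 0
            then entry P (i(k := 0))
                 + entry P (i(k := min (tsize P k - 1) 1)) * \<alpha> k ^ (2 - tsize P k)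
            else entry P (i(k := min (tsize P k - 1) (i k + 1))) * \<alpha> k ^ (i k + 2 - tsize P k))"
| "geo (IfElse E P1 P2) (P, \<alpha>) (Q, \<beta>) \<longleftrightarrow>
     (\<exists>R S \<gamma> \<delta>. is_egd (R, \<gamma>) \<and> is_egd (S, \<delta>) \<and>
        geo P1 (geo_restr E (P, \<alpha>)) (R, \<gamma>) \<and>
        geo P2 (geo_restr (ENot E) (P, \<alpha>)) (S, \<delta>) \<and>
        ((R, \<gamma>), (S, \<delta>), (Q, \<beta>)) \<in> Join)"
| "geo (While E B) (P, \<alpha>) (Q, \<beta>) \<longleftrightarrow>
     (\<exists>c R S \<gamma> \<delta>. 0 \<le> c \<and> c < 1 \<and> is_egd (R, \<gamma>) \<and> is_egd (S, \<delta>) \<and>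
        (P, \<alpha>) \<preceq>\<^sub>E (R, \<gamma>) \<and>
        geo B (geo_restr E (R, \<gamma>)) (S, \<delta>) \<and>
        (S, \<delta>) \<preceq>\<^sub>E (tscale c R, \<gamma>) \<and>
        geo_restr (ENot E) (tscale (1 / (1 - c)) R, \<gamma>) = (Q, \<beta>))"
| "geo Fail (P, \<alpha>) (Q, \<beta>) \<longleftrightarrow> \<beta> = (\<lambda>_. 0) \<and> Q = tensor (\<lambda>_. 1) (\<lambda>_. 0)"

end

theory Submission
  imports Defs
begin

text \<open>
  Restricting to an event multiplies the mass function pointwise by a weight in \<open>[0,1]\<close>, so
  programs act linearly on mass functions, and a loop is the series of its exit masses after
  \<open>n\<close> rounds. On primitive programs and events the geometric semantics is exact; it loses
  precision only at joins, where the error is arbitrarily small after a sufficiently large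
  expansion, and at loops, where the loop bound is postponed to the iteration \<open>u\<close>. The contraction
  property of the invariant makes the mass remaining then at most \<open>c ^ u\<close> times the invariant.
  Upper bounds for all intermediate errors in terms of the final bound follow from soundness and
  linearity.
\<close>

section \<open>Tensors and their masses\<close>

text \<open>The given derivation cannot simply be edited at its loops. Even for a loop-free program,
  which unrolling leaves unchanged, the bound \<open>Q\<close> may be loose, because a join may
  raise the rates of small tensors; yet the error has to vanish as u grows. Hence every join is
  chosen anew, with a size that depends on the required precision. The old derivation is kept as an
  upper bound: it fixes the rates of the new joins, keeps the new bounds below \<open>Q\<close>, and
  supplies the masses in which errors are measured. The lower half of the estimate is free:
  unrolling does not change the denotation, so soundness for the unrolled program already puts its
  bound above the true mass. In a loop each round adds a body error and a join error. They do not
  pile up, because the bound on the remaining iterations shrinks by the factor \<open>c\<close> per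
  round, so a geometric series controls the total.\<close>

lemma tsize_pos: "1 \<le> tsize T k"
  using Rep_tensor[of T] by (simp add: tsize.rep_eq split_beta)

lemma entry_outside: "\<not> (\<forall>k. i k < tsize T k) \<Longrightarrow> entry T i = 0"
  using Rep_tensor[of T] by (simp add: tsize.rep_eq entry.rep_eq split_beta)

lemma tsize_tensor: "(\<And>k. 1 \<le> s k) \<Longrightarrow> tsize (tensor s f) = s"
  by transfer (simp add: max_absorb2)

lemma tsize_tensor_tsize [simp]: "tsize (tensor (tsize P) f) = tsize P"
  by (rule tsize_tensor) (rule tsize_pos)

lemma entry_tensor:
  "(\<And>k. 1 \<le> s k) \<Longrightarrow> entry (tensor s f) i = (if \<forall>k. i k < s k then f i else 0)"
  by transfer (simp add: max_absorb2)

lemma tensor_eqI: "tsize S = tsize T \<Longrightarrow> (\<And>i. entry S i = entry T i) \<Longrightarrow> S = T"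
  by (simp add: tsize.rep_eq entry.rep_eq prod_eq_iff fun_eq_iff flip: Rep_tensor_inject)

lemma tensor_cong:
  assumes "\<And>k. 1 \<le> s k" "\<And>i. (\<And>k. i k < s k) \<Longrightarrow> f i = g i"
  shows "tensor s f = tensor s g"
proof (rule tensor_eqI)
  fix i
  show "entry (tensor s f) i = entry (tensor s g) i"
    using assms(2)[of i] by (simp add: entry_tensor[OF assms(1)])
qed (simp add: tsize_tensor[OF assms(1)])

lemma egd_mass_tensor:
  assumes "\<And>k. 1 \<le> s k"
  shows "egd_mass (tensor s f, \<beta>) x =
    f (\<lambda>k. min (x k) (s k - 1)) * (\<Prod>k\<in>UNIV. \<beta> k ^ (x k + 1 - s k))"
proof -
  have "min (x k) (s k - 1) < s k" for k
    using assms[of k] by linarith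
  then show ?thesis
    by (simp add: egd_mass_def tsize_tensor[OF assms] entry_tensor[OF assms])
qed

lemma egd_mass_in_range:
  assumes "\<And>k. x k < tsize P k"
  shows "egd_mass (P, \<alpha>) x = entry P x"
proof -
  have "min (x k) (tsize P k - 1) = x k" "x k + 1 - tsize P k = 0" for k
    using assms[of k] by linarith+
  then show ?thesis
    unfolding egd_mass_def by simp
qed

text \<open>The two clippings compose and the exponents of the two decays add up, so the mass may be
  computed from any larger size \<open>s\<close>. This is why expansions leave a mass function
  unchanged.\<close>

lemma egd_mass_clip:
  assumes "\<And>k. tsize P k \<le> s k"
  shows "egd_mass (P, \<alpha>) x =
    egd_mass (P, \<alpha>) (\<lambda>k. min (x k) (s k - 1)) * (\<Prod>k\<in>UNIV. \<alpha> k ^ (x k + 1 - s k))"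
proof -
  have *: "min (min (x k) (s k - 1)) (tsize P k - 1) = min (x k) (tsize P k - 1)"
    "min (x k) (s k - 1) + 1 - tsize P k + (x k + 1 - s k) = x k + 1 - tsize P k" for k
    using assms[of k] tsize_pos[of P k] by linarith+
  have "(\<Prod>k\<in>UNIV. \<alpha> k ^ (x k + 1 - tsize P k)) =
      (\<Prod>k\<in>UNIV. \<alpha> k ^ (min (x k) (s k - 1) + 1 - tsize P k)) * (\<Prod>k\<in>UNIV. \<alpha> k ^ (x k + 1 - s k))"
    by (simp only: flip: prod.distrib power_add) (simp only: *(2))
  then show ?thesis
    by (simp add: egd_mass_def *(1)[simplified])
qed

text \<open>Atomic statements and tests of a variable touch one coordinate; this form isolates the
  factors that belong to it.\<close>

lemma egd_mass_upd:
  "egd_mass (P, \<alpha>) (x(k := j)) =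
    entry P ((\<lambda>l. min (x l) (tsize P l - 1))(k := min j (tsize P k - 1)))
    * (\<Prod>l\<in>UNIV - {k}. \<alpha> l ^ (x l + 1 - tsize P l)) * \<alpha> k ^ (j + 1 - tsize P k)"
proof -
  have "(\<lambda>l. min ((x(k := j)) l) (tsize P l - 1))
      = (\<lambda>l. min (x l) (tsize P l - 1))(k := min j (tsize P k - 1))"
    by auto
  moreover have "(\<Prod>l\<in>UNIV. \<alpha> l ^ ((x(k := j)) l + 1 - tsize P l))
      = \<alpha> k ^ (j + 1 - tsize P k) * (\<Prod>l\<in>UNIV - {k}. \<alpha> l ^ (x l + 1 - tsize P l))"
    by (subst prod.remove[of _ k]) auto
  ultimately show ?thesis
    by (simp add: egd_mass_def)
qed

lemma egd_mass_split:
  "egd_mass (P, \<alpha>) x =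
    entry P ((\<lambda>l. min (x l) (tsize P l - 1))(k := min (x k) (tsize P k - 1)))
    * (\<Prod>l\<in>UNIV - {k}. \<alpha> l ^ (x l + 1 - tsize P l)) * \<alpha> k ^ (x k + 1 - tsize P k)"
  using egd_mass_upd[of P \<alpha> x k "x k"] by simp

lemma egd_mass_tensor_upd:
  assumes "1 \<le> n"
  shows "egd_mass (tensor ((tsize P)(k := n)) f, \<beta>) x =
    f ((\<lambda>l. min (x l) (tsize P l - 1))(k := min (x k) (n - 1)))
    * (\<Prod>l\<in>UNIV - {k}. \<beta> l ^ (x l + 1 - tsize P l)) * \<beta> k ^ (x k + 1 - n)"
proof -
  have "1 \<le> ((tsize P)(k := n)) l" for l
    using assms tsize_pos[of P l] by auto
  note * = egd_mass_tensor[OF this, where x = x]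
  have "(\<lambda>l. min (x l) (((tsize P)(k := n)) l - 1))
      = (\<lambda>l. min (x l) (tsize P l - 1))(k := min (x k) (n - 1))"
    by auto
  moreover have "(\<Prod>l\<in>UNIV. \<beta> l ^ (x l + 1 - ((tsize P)(k := n)) l))
      = \<beta> k ^ (x k + 1 - n) * (\<Prod>l\<in>UNIV - {k}. \<beta> l ^ (x l + 1 - tsize P l))"
    by (subst prod.remove[of _ k]) auto
  ultimately show ?thesis
    by (simp add: *)
qed

text \<open>In range the entries are masses and elsewhere they vanish, so nonnegativity can be read
  off a closed formula for the mass.\<close>

lemma is_egdI_mass:
  assumes "\<And>x. egd_mass (P, \<alpha>) x \<ge> 0" "\<And>k. 0 \<le> \<alpha> k \<and> \<alpha> k < 1"
  shows "is_egd (P, \<alpha>)"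
proof -
  have "0 \<le> entry P i" for i
    using assms(1)[of i] egd_mass_in_range[of i P \<alpha>] entry_outside[of i P] by fastforce
  then show ?thesis
    using assms(2) by (simp add: is_egd_def)
qed

lemma egd_mass_nonneg: "is_egd D \<Longrightarrow> 0 \<le> egd_mass D x"
  by (cases D) (auto simp: is_egd_def egd_mass_def intro!: mult_nonneg_nonneg prod_nonneg)

lemma egd_mass_tscale: "egd_mass (tscale c P, \<alpha>) x = c * egd_mass (P, \<alpha>) x"
proof -
  have "egd_mass (tscale c P, \<alpha>) x = c * entry P (\<lambda>k. min (x k) (tsize P k - 1))
     * (\<Prod>k\<in>UNIV. \<alpha> k ^ (x k + 1 - tsize P k))"
    unfolding tscale_def by (rule egd_mass_tensor) (rule tsize_pos)
  then show ?thesis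
    by (simp add: egd_mass_def)
qed

lemma is_egd_tscale:
  fixes P :: "'n::finite tensor"
  assumes "is_egd (P, \<alpha>)" "0 \<le> c"
  shows "is_egd (tscale c P, \<alpha>)"
  using assms egd_mass_nonneg[OF assms(1)]
  by (intro is_egdI_mass) (auto simp: egd_mass_tscale is_egd_def)

text \<open>Beyond the common size both masses continue from a boundary value by powers of their
  rates, and these are ordered too, so the finite test decides the comparison everywhere.\<close>

lemma egd_le_iff:
  assumes "is_egd D" "is_egd D'"
  shows "D \<preceq>\<^sub>E D' \<longleftrightarrow> (\<forall>k. snd D k \<le> snd D' k) \<and> (\<forall>x. egd_mass D x \<le> egd_mass D' x)"
proof (intro iffI conjI)
  assume le: "D \<preceq>\<^sub>E D'"
  then show "\<forall>k. snd D k \<le> snd D' k"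
    by (simp add: egd_le_def)
  show "\<forall>x. egd_mass D x \<le> egd_mass D' x"
  proof
    fix x
    obtain P \<alpha> Q \<beta> where D: "D = (P, \<alpha>)" "D' = (Q, \<beta>)"
      by (cases D, cases D') auto
    define s where "s = (\<lambda>k. max (tsize P k) (tsize Q k))"
    define y where "y = (\<lambda>k. min (x k) (s k - 1))"
    have "y k < s k" for k
      using tsize_pos[of P k] by (auto simp: y_def s_def)
    then have *: "egd_mass D y \<le> egd_mass D' y"
      using le D by (simp add: egd_le_def s_def)
    have ab: "0 \<le> \<alpha> k" "\<alpha> k \<le> \<beta> k" for k
      using assms le D by (auto simp: egd_le_def is_egd_def)
    have "egd_mass D x = egd_mass D y * (\<Prod>k\<in>UNIV. \<alpha> k ^ (x k + 1 - s k))"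
      unfolding D y_def by (rule egd_mass_clip) (simp add: s_def)
    also have "\<dots> \<le> egd_mass D' y * (\<Prod>k\<in>UNIV. \<beta> k ^ (x k + 1 - s k))"
      using ab * assms by (intro mult_mono prod_mono conjI power_mono prod_nonneg egd_mass_nonneg) auto
    also have "\<dots> = egd_mass D' x"
      unfolding D y_def by (rule egd_mass_clip[symmetric]) (simp add: s_def)
    finally show "egd_mass D x \<le> egd_mass D' x" .
  qed
qed (auto simp: egd_le_def)

section \<open>Events as weights\<close>

primrec weight :: "'n event \<Rightarrow> 'n state \<Rightarrow> real" where
  "weight (VarEq k a) x = of_bool (x k = a)"
| "weight (Flip \<rho>) x = \<rho>"
| "weight (ENot E) x = 1 - weight E x"
| "weight (EAnd E1 E2) x = weight E1 x * weight E2 x"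

lemma weight_bounds: "wf_event E \<Longrightarrow> 0 \<le> weight E x \<and> weight E x \<le> 1"
  by (induction E) (auto intro: mult_le_one)

text \<open>The variables whose rate the restriction resets to 0. A negation returns to the original
  rates, whatever the negated event has reset, hence the empty set.\<close>

primrec zeroed :: "'n event \<Rightarrow> 'n set" where
  "zeroed (VarEq k a) = {k}"
| "zeroed (Flip \<rho>) = {}"
| "zeroed (ENot E) = {}"
| "zeroed (EAnd E1 E2) = zeroed E1 \<union> zeroed E2"

lemma snd_geo_restr: "snd (geo_restr E D) = (\<lambda>k. if k \<in> zeroed E then 0 else snd D k)"
  by (induction E D rule: geo_restr.induct) (auto simp: Let_def)

lemma snd_geo_restr_mono:
  assumes "is_egd D" "is_egd D'" "\<And>k. snd D k \<le> snd D' k"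
  shows "snd (geo_restr E D) k \<le> snd (geo_restr E D') k"
  using assms by (auto simp: snd_geo_restr)

text \<open>
  The weight of an event depends only on the arguments clipped to the size of the restricted
  tensor; this makes the complement in the case \<open>ENot\<close> exact beyond the size as well.
\<close>

lemma geo_restr_exact:
  "(\<forall>k. tsize (fst D) k \<le> tsize (fst (geo_restr E D)) k) \<and>
   (\<forall>s x. (\<forall>k. tsize (fst (geo_restr E D)) k \<le> s k) \<longrightarrow>
      weight E (\<lambda>k. min (x k) (s k - 1)) = weight E x) \<and>
   (\<forall>x. egd_mass (geo_restr E D) x = weight E x * egd_mass D x)"
proof (induction E D rule: geo_restr.induct)
  case (1 k a P \<alpha>)
  let ?n = "max (tsize P k) (a + 2)"
  let ?f = "\<lambda>i. entry P (i(k := min (i k) (tsize P k - 1))) * \<alpha> k ^ (i k + 1 - tsize P k)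
             * of_bool (i k = a)"
  have pos: "1 \<le> ((tsize P)(k := ?n)) l" for l
    using tsize_pos[of P l] by auto
  have size: "tsize (fst (geo_restr (VarEq k a) (P, \<alpha>))) = (tsize P)(k := ?n)"
    unfolding geo_restr.simps fst_conv by (rule tsize_tensor) (rule pos)
  \<comment> \<open>The size \<open>a + 2\<close> rather than \<open>a + 1\<close> matters here: the
    last index differs from \<open>a\<close>, so clipping never turns a larger argument into
    \<open>a\<close>.\<close>
  have eq: "min m (n - 1) = a \<longleftrightarrow> m = a" if "a + 2 \<le> n" for m n :: nat
    using that by auto
  have "egd_mass (geo_restr (VarEq k a) (P, \<alpha>)) x = weight (VarEq k a) x * egd_mass (P, \<alpha>) x" for x
  proof (cases "x k = a")
    case True
    \<comment> \<open>At \<open>x k = a\<close> the exponent of the new rate 0 is itself 0, so by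
      \<open>0 ^ 0 = 1\<close> the reset has no effect at this point.\<close>
    have "min a (?n - 1) = a"
      by simp
    then have "egd_mass (geo_restr (VarEq k a) (P, \<alpha>)) x =
      entry P ((\<lambda>l. min (x l) (tsize P l - 1))(k := min (x k) (tsize P k - 1)))
      * \<alpha> k ^ (x k + 1 - tsize P k) * (\<Prod>l\<in>UNIV - {k}. (\<alpha>(k := 0)) l ^ (x l + 1 - tsize P l))"
      using True unfolding geo_restr.simps by (subst egd_mass_tensor_upd) auto
    also have "(\<Prod>l\<in>UNIV - {k}. (\<alpha>(k := 0)) l ^ (x l + 1 - tsize P l))
        = (\<Prod>l\<in>UNIV - {k}. \<alpha> l ^ (x l + 1 - tsize P l))"
      by (rule prod.cong) auto
    finally show ?thesis
      using True by (simp add: egd_mass_split[of P \<alpha> x k] fun_upd_def)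
  next
    case False
    then have "min (x k) (?n - 1) \<noteq> a"
      using eq[of ?n "x k"] by simp
    then show ?thesis
      using False unfolding geo_restr.simps by (subst egd_mass_tensor_upd) auto
  qed
  moreover have "weight (VarEq k a) (\<lambda>l. min (x l) (s l - 1)) = weight (VarEq k a) x"
    if "\<forall>l. tsize (fst (geo_restr (VarEq k a) (P, \<alpha>))) l \<le> s l" for s x
    using that[rule_format, of k] eq[of "s k" "x k"] unfolding size by simp
  moreover have "tsize (fst (P, \<alpha>)) l \<le> tsize (fst (geo_restr (VarEq k a) (P, \<alpha>))) l" for l
    unfolding size by simp
  ultimately show ?case
    by blast
next
  case (2 \<rho> P \<alpha>)
  then show ?case
    by (simp add: egd_mass_tscale) (simp add: tscale_def)
next
  case (3 E P \<alpha>)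
  let ?R = "fst (geo_restr E (P, \<alpha>))"
  have size: "fst (geo_restr (ENot E) (P, \<alpha>)) = tensor (tsize ?R) (\<lambda>i. egd_mass (P, \<alpha>) i - entry ?R i)"
    by (simp add: Let_def)
  have size': "tsize (fst (geo_restr (ENot E) (P, \<alpha>))) = tsize ?R"
    unfolding size by (rule tsize_tensor) (rule tsize_pos)
  have le: "tsize P k \<le> tsize ?R k" for k
    using 3 by auto
  have "egd_mass (geo_restr (ENot E) (P, \<alpha>)) x = weight (ENot E) x * egd_mass (P, \<alpha>) x" for x
  proof -
    let ?y = "\<lambda>k. min (x k) (tsize ?R k - 1)"
    have "?y k < tsize ?R k" for k
      using tsize_pos[of ?R k] by linarith
    then have "entry ?R ?y = egd_mass (geo_restr E (P, \<alpha>)) ?y"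
      using egd_mass_in_range[of ?y ?R "snd (geo_restr E (P, \<alpha>))"] by simp
    \<comment> \<open>Clipping to the size of \<open>?R\<close> does not change the weight, by the
      induction hypothesis.\<close>
    also have "\<dots> = weight E x * egd_mass (P, \<alpha>) ?y"
      using 3 by auto
    finally have "entry ?R ?y = weight E x * egd_mass (P, \<alpha>) ?y" .
    moreover have "egd_mass (geo_restr (ENot E) (P, \<alpha>)) x =
        (egd_mass (P, \<alpha>) ?y - entry ?R ?y) * (\<Prod>k\<in>UNIV. \<alpha> k ^ (x k + 1 - tsize ?R k))"
      unfolding geo_restr.simps Let_def by (rule egd_mass_tensor) (rule tsize_pos)
    moreover have "egd_mass (P, \<alpha>) x =
        egd_mass (P, \<alpha>) ?y * (\<Prod>k\<in>UNIV. \<alpha> k ^ (x k + 1 - tsize ?R k))"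
      by (rule egd_mass_clip) (rule le)
    ultimately show ?thesis
      by (simp add: algebra_simps)
  qed
  then show ?case
    using 3 by (simp add: size' del: geo_restr.simps)
next
  case (4 E1 E2 P \<alpha>)
  let ?D = "geo_restr E1 (P, \<alpha>)"
  have "tsize (fst ?D) k \<le> tsize (fst (geo_restr E2 ?D)) k" for k
    using 4 by blast
  moreover from this have "tsize P k \<le> tsize (fst (geo_restr E2 ?D)) k" for k
    using 4(1) by (metis fst_conv order_trans)
  moreover have "weight E1 (\<lambda>k. min (x k) (s k - 1)) = weight E1 x"
    if "\<forall>k. tsize (fst (geo_restr E2 ?D)) k \<le> s k" for s x
    using 4(1) that calculation(1) by (meson order_trans)
  ultimately show ?case
    using 4 by (simp add: mult_ac)
qed

lemma egd_mass_geo_restr: "egd_mass (geo_restr E D) x = weight E x * egd_mass D x"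
  using geo_restr_exact by blast

lemma is_egd_geo_restr:
  assumes "is_egd D" "wf_event E"
  shows "is_egd (geo_restr E D)"
proof -
  have "is_egd (fst (geo_restr E D), snd (geo_restr E D))"
  proof (rule is_egdI_mass)
    show "0 \<le> egd_mass (fst (geo_restr E D), snd (geo_restr E D)) x" for x
      using assms by (simp add: egd_mass_geo_restr weight_bounds egd_mass_nonneg)
    show "0 \<le> snd (geo_restr E D) k \<and> snd (geo_restr E D) k < 1" for k
      using assms(1) by (auto simp: snd_geo_restr is_egd_def split: prod.splits)
  qed
  then show ?thesis
    by simp
qed

section \<open>Joins\<close>

text \<open>
  Replacing the decay rates of an expansion by larger ones spoils only the entries beyond its
  size. These are negligible compared to an upper bound with the larger rates once the size is
  large, because on the boundary of the index range the ratio has already decayed like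
  \<open>(\<alpha> k / \<beta> k) ^ N\<close>.
\<close>

lemma egd_mass_relax:
  fixes P U :: "'n::finite tensor"
  assumes egd: "is_egd (P, \<alpha>)" "is_egd (U, \<beta>)"
    and ab: "\<And>k. \<alpha> k \<le> \<beta> k"
    and bound: "\<And>x. egd_mass (P, \<alpha>) x \<le> egd_mass (U, \<beta>) x"
    and \<epsilon>: "0 < \<epsilon>"
    and N: "\<And>k. \<alpha> k < \<beta> k \<Longrightarrow> \<alpha> k ^ N \<le> \<epsilon> * \<beta> k ^ N"
    and s: "\<And>k. tsize P k + N \<le> s k" "\<And>k. tsize U k + N \<le> s k"
  shows "egd_mass (P, \<alpha>) (\<lambda>k. min (x k) (s k - 1)) * (\<Prod>k\<in>UNIV. \<beta> k ^ (x k + 1 - s k))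
    \<le> egd_mass (P, \<alpha>) x + \<epsilon> * egd_mass (U, \<beta>) x"
proof -
  let ?y = "\<lambda>k. min (x k) (s k - 1)"
  have a0: "0 \<le> \<alpha> k" "0 \<le> \<beta> k" for k
    using egd by (auto simp: is_egd_def)
  have clipP: "egd_mass (P, \<alpha>) x = egd_mass (P, \<alpha>) ?y * (\<Prod>k\<in>UNIV. \<alpha> k ^ (x k + 1 - s k))"
    by (rule egd_mass_clip) (use s(1) in \<open>auto intro: add_leD1\<close>)
  have clipU: "egd_mass (U, \<beta>) x = egd_mass (U, \<beta>) ?y * (\<Prod>k\<in>UNIV. \<beta> k ^ (x k + 1 - s k))"
    by (rule egd_mass_clip) (use s(2) in \<open>auto intro: add_leD1\<close>)
  have prod0: "0 \<le> (\<Prod>k\<in>UNIV. \<beta> k ^ (x k + 1 - s k))"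
    using a0 by (auto intro: prod_nonneg)
  show ?thesis
  \<comment> \<open>Either the rates agree in every coordinate that exceeds the size, and nothing
    changes, or some such coordinate has a strictly smaller rate and alone makes the mass
    negligible.\<close>
  proof (cases "\<forall>k. s k \<le> x k \<longrightarrow> \<alpha> k = \<beta> k")
    case True
    have "\<beta> k ^ (x k + 1 - s k) = \<alpha> k ^ (x k + 1 - s k)" for k
      using True by (cases "s k \<le> x k") auto
    then show ?thesis
      using clipP egd_mass_nonneg[OF egd(2), of x] \<epsilon> by simp
  next
    case False
    then obtain k where k: "s k \<le> x k" "\<alpha> k < \<beta> k"
      using ab by (auto simp: order_less_le)
    \<comment> \<open>Position \<open>n\<close> lies at or beyond the last index of both tensors,
      and \<open>N\<close> further steps lead to the clipped position, so each mass picks up the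
      \<open>N\<close>-th power of its own rate.\<close>
    define n where "n = s k - 1 - N"
    have n: "tsize P k - 1 \<le> n" "tsize U k - 1 \<le> n" "n + N = s k - 1"
      using s(1)[of k] s(2)[of k] tsize_pos[of P k] by (auto simp: n_def)
    have upd: "?y = ?y(k := n + N)"
      using k n by auto
    have shift: "egd_mass (T, \<gamma>) ?y = egd_mass (T, \<gamma>) (?y(k := n)) * \<gamma> k ^ N"
      if "tsize T k - 1 \<le> n" for T :: "'n tensor" and \<gamma>
    proof -
      have "min (n + N) (tsize T k - 1) = min n (tsize T k - 1)"
        "n + N + 1 - tsize T k = (n + 1 - tsize T k) + N"
        using that tsize_pos[of T k] by linarith+
      then show ?thesis
        by (subst upd) (simp only: egd_mass_upd power_add mult.assoc)
    qed
    have "egd_mass (P, \<alpha>) ?y = egd_mass (P, \<alpha>) (?y(k := n)) * \<alpha> k ^ N"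
      by (rule shift) (rule n)
    also have "\<dots> \<le> egd_mass (U, \<beta>) (?y(k := n)) * (\<epsilon> * \<beta> k ^ N)"
      using bound N[OF k(2)] a0 egd by (intro mult_mono egd_mass_nonneg) auto
    also have "\<dots> = \<epsilon> * egd_mass (U, \<beta>) ?y"
      by (subst shift[of U]) (use n in auto)
    finally have "egd_mass (P, \<alpha>) ?y * (\<Prod>k\<in>UNIV. \<beta> k ^ (x k + 1 - s k))
        \<le> \<epsilon> * egd_mass (U, \<beta>) x"
      unfolding clipU using prod0 by (simp add: mult_right_mono flip: mult.assoc)
    then show ?thesis
      using egd_mass_nonneg[OF egd(1), of x] by simp
  qed
qed

lemma eventually_power_le:
  fixes a b \<epsilon> :: real
  assumes "0 \<le> a" "a < b" "0 < \<epsilon>"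
  shows "\<forall>\<^sub>F n in sequentially. a ^ n \<le> \<epsilon> * b ^ n"
proof -
  have "(\<lambda>n. (a / b) ^ n) \<longlonglongrightarrow> 0"
    using assms by (intro LIMSEQ_power_zero) (simp add: field_simps)
  then have "\<forall>\<^sub>F n in sequentially. (a / b) ^ n < \<epsilon>"
    using assms(3) by (rule order_tendstoD)
  then show ?thesis
    using assms by (auto elim!: eventually_mono simp: power_divide field_simps)
qed

text \<open>\<open>U\<close> carries the target rates and dominates the sum. It is both the unit of
  the error and the ceiling for the result, so precision is gained without leaving the given
  bound.\<close>

lemma Join_approx:
  fixes D1 D2 :: "'n::finite egd"
  assumes egd: "is_egd D1" "is_egd D2" "is_egd (U, \<beta>)"
    and exps: "\<And>k. snd D1 k \<le> \<beta> k" "\<And>k. snd D2 k \<le> \<beta> k"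
    and bound: "\<And>x. egd_mass D1 x + egd_mass D2 x \<le> egd_mass (U, \<beta>) x"
    and \<epsilon>: "0 < \<epsilon>"
  obtains Q where "(D1, D2, (Q, \<beta>)) \<in> Join" "is_egd (Q, \<beta>)" "(Q, \<beta>) \<preceq>\<^sub>E (U, \<beta>)"
    "\<And>x. egd_mass (Q, \<beta>) x \<le> egd_mass D1 x + egd_mass D2 x + \<epsilon> * egd_mass (U, \<beta>) x"
proof -
  obtain R \<gamma> S \<delta> where D: "D1 = (R, \<gamma>)" "D2 = (S, \<delta>)"
    by (cases D1, cases D2) auto
  \<comment> \<open>Finitely many coordinates admit a common \<open>N\<close>; each of the two
    branches is allotted half of \<epsilon>.\<close>
  have ev: "\<forall>\<^sub>F N in sequentially. \<forall>k. \<eta> k < \<beta> k \<longrightarrow> \<eta> k ^ N \<le> \<epsilon> / 2 * \<beta> k ^ N"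
    if "\<And>k. 0 \<le> \<eta> k" for \<eta> :: "'n \<Rightarrow> real"
  proof (rule eventually_all_finite)
    fix k
    show "\<forall>\<^sub>F N in sequentially. \<eta> k < \<beta> k \<longrightarrow> \<eta> k ^ N \<le> \<epsilon> / 2 * \<beta> k ^ N"
      using eventually_power_le[of "\<eta> k" "\<beta> k" "\<epsilon> / 2"] that[of k] \<epsilon> by (cases "\<eta> k < \<beta> k") auto
  qed
  have "\<forall>\<^sub>F N in sequentially. (\<forall>k. \<gamma> k < \<beta> k \<longrightarrow> \<gamma> k ^ N \<le> \<epsilon> / 2 * \<beta> k ^ N) \<and>
      (\<forall>k. \<delta> k < \<beta> k \<longrightarrow> \<delta> k ^ N \<le> \<epsilon> / 2 * \<beta> k ^ N)"
    using egd by (intro eventually_conj ev) (auto simp: D is_egd_def)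
  then obtain N where N: "\<And>k. \<gamma> k < \<beta> k \<Longrightarrow> \<gamma> k ^ N \<le> \<epsilon> / 2 * \<beta> k ^ N"
      "\<And>k. \<delta> k < \<beta> k \<Longrightarrow> \<delta> k ^ N \<le> \<epsilon> / 2 * \<beta> k ^ N"
    unfolding eventually_sequentially by blast
  \<comment> \<open>Covering the size of \<open>U\<close> as well reduces the comparison with
    \<open>U\<close> to indices in range, where the join is the exact sum.\<close>
  define s where "s = (\<lambda>k. max (tsize R k) (max (tsize S k) (tsize U k)) + N)"
  have s: "1 \<le> s k" "tsize R k + N \<le> s k" "tsize S k + N \<le> s k" "tsize U k + N \<le> s k" for k
    using tsize_pos[of R k] by (auto simp: s_def)
  have s': "tsize R k \<le> s k" "tsize S k \<le> s k" "tsize U k \<le> s k" for k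
    using s[of k] by auto
  define Q where "Q = tensor s (\<lambda>i. egd_mass D1 i + egd_mass D2 i)"
  have size: "tsize Q = s"
    unfolding Q_def by (rule tsize_tensor) (rule s)
  have mass: "egd_mass (Q, \<beta>) x =
      (egd_mass D1 (\<lambda>k. min (x k) (s k - 1)) + egd_mass D2 (\<lambda>k. min (x k) (s k - 1)))
      * (\<Prod>k\<in>UNIV. \<beta> k ^ (x k + 1 - s k))" for x
    unfolding Q_def by (rule egd_mass_tensor) (rule s)
  have b: "0 \<le> \<beta> k" "\<beta> k < 1" for k
    using egd(3) by (auto simp: is_egd_def)
  have n0: "0 \<le> egd_mass D1 x" "0 \<le> egd_mass D2 x" for x
    using egd by (auto intro: egd_mass_nonneg)
  have le1: "egd_mass D1 x \<le> egd_mass (U, \<beta>) x" "egd_mass D2 x \<le> egd_mass (U, \<beta>) x" for x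
    using bound[of x] n0[of x] by linarith+
  have isegd: "is_egd (Q, \<beta>)"
    using b n0 by (intro is_egdI_mass) (auto simp: mass intro!: mult_nonneg_nonneg prod_nonneg)
  show ?thesis
  proof (rule that)
    have "is_expansion (T, \<eta>) (tensor s (egd_mass (T, \<eta>)))" if "\<And>k. tsize T k \<le> s k"
      for T :: "'n tensor" and \<eta>
      using that s(1) by (simp add: is_expansion_def tsize_tensor entry_tensor)
    then have exp: "is_expansion (R, \<gamma>) (tensor s (egd_mass D1))"
      "is_expansion (S, \<delta>) (tensor s (egd_mass D2))"
      using s' by (auto simp: D)
    have "Q = tensor s (\<lambda>i. entry (tensor s (egd_mass D1)) i + entry (tensor s (egd_mass D2)) i)"
      unfolding Q_def by (rule tensor_cong) (use s(1) in \<open>simp_all add: entry_tensor\<close>)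
    then have "\<exists>R' S'. is_expansion (R, \<gamma>) R' \<and> is_expansion (S, \<delta>) S' \<and> tsize R' = tsize S' \<and>
        Q = tensor (tsize R') (\<lambda>i. entry R' i + entry S' i)"
      using exp s(1) by (intro exI[of _ "tensor s (egd_mass D1)"] exI[of _ "tensor s (egd_mass D2)"])
        (simp add: tsize_tensor)
    then show "(D1, D2, (Q, \<beta>)) \<in> Join"
      using exps by (simp add: Join_def D)
    show "(Q, \<beta>) \<preceq>\<^sub>E (U, \<beta>)"
      unfolding egd_le_def
    proof (intro conjI allI impI)
      fix i assume "\<forall>k. i k < max (tsize (fst (Q, \<beta>)) k) (tsize (fst (U, \<beta>)) k)"
      then have i: "i k < s k" for k
        using s'(3)[of k] by (auto simp: size less_max_iff_disj intro: order.strict_trans2)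
      then have "min (i k) (s k - 1) = i k" "i k + 1 - s k = 0" for k
        using i[of k] by linarith+
      then show "egd_mass (Q, \<beta>) i \<le> egd_mass (U, \<beta>) i"
        using bound[of i] by (simp add: mass)
    qed simp
    fix x
    have "egd_mass (R, \<gamma>) (\<lambda>k. min (x k) (s k - 1)) * (\<Prod>k\<in>UNIV. \<beta> k ^ (x k + 1 - s k))
        \<le> egd_mass (R, \<gamma>) x + \<epsilon> / 2 * egd_mass (U, \<beta>) x"
      using egd exps le1 \<epsilon> s N unfolding D by (intro egd_mass_relax[where N = N]) auto
    moreover have "egd_mass (S, \<delta>) (\<lambda>k. min (x k) (s k - 1)) * (\<Prod>k\<in>UNIV. \<beta> k ^ (x k + 1 - s k))
        \<le> egd_mass (S, \<delta>) x + \<epsilon> / 2 * egd_mass (U, \<beta>) x"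
      using egd exps le1 \<epsilon> s N unfolding D by (intro egd_mass_relax[where N = N]) auto
    ultimately show "egd_mass (Q, \<beta>) x \<le> egd_mass D1 x + egd_mass D2 x + \<epsilon> * egd_mass (U, \<beta>) x"
      by (simp add: mass D algebra_simps)
  qed (rule isegd)
qed

text \<open>The entries of a join are the exact sums; outside the range its larger rates can only
  increase the masses.\<close>

lemma Join_mass_le:
  assumes "(D1, D2, D3) \<in> Join" "is_egd D1" "is_egd D2" "is_egd D3"
  shows "egd_mass D1 x + egd_mass D2 x \<le> egd_mass D3 x"
proof -
  from assms(1) obtain R \<gamma> S \<delta> \<beta> R' S' where D: "D1 = (R, \<gamma>)" "D2 = (S, \<delta>)"
    "D3 = (tensor (tsize R') (\<lambda>i. entry R' i + entry S' i), \<beta>)"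
    and le: "\<And>k. \<gamma> k \<le> \<beta> k" "\<And>k. \<delta> k \<le> \<beta> k"
    and exp: "is_expansion (R, \<gamma>) R'" "is_expansion (S, \<delta>) S'" "tsize R' = tsize S'"
    by (auto simp: Join_def)
  let ?y = "\<lambda>k. min (x k) (tsize R' k - 1)"
  have y: "?y k < tsize R' k" for k
    using tsize_pos[of R' k] by linarith
  have e: "entry R' ?y = egd_mass D1 ?y" "entry S' ?y = egd_mass D2 ?y"
    using exp y by (auto simp: is_expansion_def D)
  have nn: "0 \<le> egd_mass D1 ?y" "0 \<le> egd_mass D2 ?y"
    using assms by (auto intro: egd_mass_nonneg)
  have ab: "0 \<le> \<gamma> k" "0 \<le> \<delta> k" for k
    using assms by (auto simp: is_egd_def D)
  have "egd_mass D1 x = egd_mass D1 ?y * (\<Prod>k\<in>UNIV. \<gamma> k ^ (x k + 1 - tsize R' k))"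
    unfolding D by (rule egd_mass_clip) (use exp in \<open>auto simp: is_expansion_def\<close>)
  moreover have "\<dots> \<le> egd_mass D1 ?y * (\<Prod>k\<in>UNIV. \<beta> k ^ (x k + 1 - tsize R' k))"
    using le nn ab by (intro mult_left_mono prod_mono conjI power_mono zero_le_power) auto
  moreover have "egd_mass D2 x = egd_mass D2 ?y * (\<Prod>k\<in>UNIV. \<delta> k ^ (x k + 1 - tsize R' k))"
    unfolding D by (rule egd_mass_clip) (use exp in \<open>auto simp: is_expansion_def\<close>)
  moreover have "\<dots> \<le> egd_mass D2 ?y * (\<Prod>k\<in>UNIV. \<beta> k ^ (x k + 1 - tsize R' k))"
    using le nn ab by (intro mult_left_mono prod_mono conjI power_mono zero_le_power) auto
  moreover have "egd_mass D3 x =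
      (entry R' ?y + entry S' ?y) * (\<Prod>k\<in>UNIV. \<beta> k ^ (x k + 1 - tsize R' k))"
    unfolding D by (rule egd_mass_tensor) (rule tsize_pos)
  ultimately show ?thesis
    unfolding e by (simp add: distrib_right)
qed

section \<open>Programs as linear maps on mass functions\<close>

text \<open>Setting a variable to 0 has infinite fibres, hence an integral over the counting measure
  instead of a finite sum.\<close>

definition push :: "('a \<Rightarrow> 'b) \<Rightarrow> ('a \<Rightarrow> ennreal) \<Rightarrow> 'b \<Rightarrow> ennreal" where
  "push h f y = (\<integral>\<^sup>+x. f x \<partial>count_space (h -` {y}))"

definition reweight :: "'n event \<Rightarrow> ('n state \<Rightarrow> ennreal) \<Rightarrow> 'n state \<Rightarrow> ennreal" where
  "reweight E f x = ennreal (weight E x) * f x"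

text \<open>The mass of normally terminating runs only: failure contributes nothing. Values in
  \<open>ennreal\<close> spare the series all convergence conditions and make the map linear on
  arbitrary mass functions.\<close>

primrec denot :: "'n prog \<Rightarrow> ('n state \<Rightarrow> ennreal) \<Rightarrow> 'n state \<Rightarrow> ennreal" where
  "denot Skip = (\<lambda>f. f)"
| "denot (Seq P1 P2) = (\<lambda>f. denot P2 (denot P1 f))"
| "denot (SetZero k) = push (\<lambda>x. x(k := 0))"
| "denot (Incr k a) = push (\<lambda>x. x(k := x k + a))"
| "denot (Decr k) = push (\<lambda>x. x(k := x k - 1))"
| "denot (IfElse E P1 P2) =
     (\<lambda>f y. denot P1 (reweight E f) y + denot P2 (reweight (ENot E) f) y)"
| "denot (While E B) =
     (\<lambda>f y. \<Sum>n. reweight (ENot E) (((\<lambda>g. denot B (reweight E g)) ^^ n) f) y)"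
| "denot Fail = (\<lambda>f y. 0)"

lemma push_add: "push h (\<lambda>x. f x + g x) = (\<lambda>y. push h f y + push h g y)"
  by (simp add: push_def nn_integral_add fun_eq_iff)

lemma push_cmult: "push h (\<lambda>x. c * f x) = (\<lambda>y. c * push h f y)"
  by (simp add: push_def nn_integral_cmult fun_eq_iff)

lemma reweight_add: "reweight E (\<lambda>x. f x + g x) = (\<lambda>x. reweight E f x + reweight E g x)"
  by (simp add: reweight_def fun_eq_iff distrib_left)

lemma reweight_cmult: "reweight E (\<lambda>x. c * f x) = (\<lambda>x. c * reweight E f x)"
  by (simp add: reweight_def fun_eq_iff mult.left_commute)

lemma reweight_mono: "(\<And>x. f x \<le> g x) \<Longrightarrow> reweight E f x \<le> reweight E g x"
  by (simp add: reweight_def mult_left_mono)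

lemma denot_add: "denot P (\<lambda>x. f x + g x) = (\<lambda>y. denot P f y + denot P g y)"
proof (induction P arbitrary: f g)
  case (While E B)
  let ?T = "\<lambda>f. denot B (reweight E f)"
  have "(?T ^^ n) (\<lambda>x. f x + g x) = (\<lambda>x. (?T ^^ n) f x + (?T ^^ n) g x)" for n
    by (induction n) (simp_all add: reweight_add While)
  then show ?case
    by (simp add: reweight_add suminf_add)
qed (simp_all add: push_add reweight_add add_ac)

lemma denot_cmult: "denot P (\<lambda>x. c * f x) = (\<lambda>y. c * denot P f y)"
proof (induction P arbitrary: f)
  case (While E B)
  let ?T = "\<lambda>f. denot B (reweight E f)"
  have "(?T ^^ n) (\<lambda>x. c * f x) = (\<lambda>x. c * (?T ^^ n) f x)" for n
    by (induction n) (simp_all add: reweight_cmult While)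
  then show ?case
    by (simp add: reweight_cmult)
qed (simp_all add: push_cmult reweight_cmult distrib_left)

text \<open>Follows from additivity, since \<open>g\<close> is \<open>f\<close> plus the nonnegative
  function \<open>g - f\<close>.\<close>

lemma denot_mono:
  assumes "\<And>x. f x \<le> g x"
  shows "denot P f y \<le> denot P g y"
proof -
  have "g = (\<lambda>x. f x + (g x - f x))"
    using assms by (auto simp: add_diff_inverse_ennreal)
  then show ?thesis
    using denot_add[of P f "\<lambda>x. g x - f x"] by simp
qed

lemma denot_le_cmult:
  assumes "\<And>x. f x \<le> c * g x"
  shows "denot P f y \<le> c * denot P g y"
  using denot_mono[of f "\<lambda>x. c * g x" P y] assms by (simp add: denot_cmult)

text \<open>Once the term for zero rounds is split off, the first round of the other terms moves
  inside and leaves the same series for another input.\<close>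

lemma denot_While_unfold:
  "denot (While E B) f y = reweight (ENot E) f y + denot (While E B) (denot B (reweight E f)) y"
proof -
  let ?T = "\<lambda>f. denot B (reweight E f)"
  let ?g = "\<lambda>n. reweight (ENot E) ((?T ^^ n) f) y"
  have "denot (While E B) f y = ?g 0 + (\<Sum>n. ?g (Suc n))"
    using suminf_offset[of ?g 1] by (simp del: funpow.simps)
  then show ?thesis
    by (simp only: denot.simps funpow_Suc_right o_apply funpow_0)
qed

text \<open>Each copy of the body is peeled off by \<open>denot_While_unfold\<close>. Together with
  soundness this places every bound for an unrolled program above the true mass.\<close>

lemma denot_unroll: "denot (unroll u P) = denot P"
proof (induction P)
  case (While E B)
  have "denot (unroll_loop E (unroll u B) u v) = denot (While E B)" for v
  proof (induction "u - v" arbitrary: v)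
    case 0
    then show ?case
      using While by (subst unroll_loop.simps) simp
  next
    case (Suc d)
    then have IH: "denot (unroll_loop E (unroll u B) u (v + 1)) = denot (While E B)" and "v < u"
      by simp_all
    show ?case
    proof
      fix f
      have "denot (unroll_loop E (unroll u B) u v) f =
          (\<lambda>y. denot (While E B) (denot B (reweight E f)) y + reweight (ENot E) f y)"
        using IH While \<open>v < u\<close> by (subst unroll_loop.simps) simp
      then show "denot (unroll_loop E (unroll u B) u v) f = denot (While E B) f"
        using denot_While_unfold[of E B f] by (intro ext) (simp only: add.commute)
    qed
  qed
  then show ?case
    by simp
qed auto

section \<open>Soundness of the geometric bounds\<close>

abbreviation emass :: "'n::finite egd \<Rightarrow> 'n state \<Rightarrow> ennreal" where
  "emass D x \<equiv> ennreal (egd_mass D x)"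

lemma emass_geo_restr: "wf_event E \<Longrightarrow> emass (geo_restr E D) = reweight E (emass D)"
  by (simp add: fun_eq_iff reweight_def egd_mass_geo_restr ennreal_mult' weight_bounds)

section \<open>Inversion of the bound relation and exactness on atomic statements\<close>

lemma geo_Skip: "geo Skip D F \<longleftrightarrow> F = D"
  by (cases D, cases F) auto

lemma geo_Seq:
  "geo (Seq P1 P2) D F \<longleftrightarrow> (\<exists>R. is_egd R \<and> geo P1 D R \<and> geo P2 R F)"
  by (cases D, cases F) auto

lemma geo_IfElse:
  "geo (IfElse E P1 P2) D F \<longleftrightarrow>
     (\<exists>R S. is_egd R \<and> is_egd S \<and> geo P1 (geo_restr E D) R \<and>
        geo P2 (geo_restr (ENot E) D) S \<and> (R, S, F) \<in> Join)"
  by (cases D, cases F) (auto simp del: geo_restr.simps)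

lemma geo_While:
  "geo (While E B) D F \<longleftrightarrow>
     (\<exists>c R S. 0 \<le> c \<and> c < 1 \<and> is_egd R \<and> is_egd S \<and> D \<preceq>\<^sub>E R \<and> geo B (geo_restr E R) S \<and>
        S \<preceq>\<^sub>E (tscale c (fst R), snd R) \<and>
        geo_restr (ENot E) (tscale (1 / (1 - c)) (fst R), snd R) = F)"
  by (cases D; cases F) (simp only: geo.simps split_paired_Ex fst_conv snd_conv, blast)

text \<open>Along coordinate \<open>k\<close> the masses from the last index on form a geometric
  series, which explains the quotient by \<open>1 - \<alpha> k\<close>. The form \<open>sums\<close>
  also records convergence, needed to pass to \<open>ennreal\<close>.\<close>

lemma egd_mass_SetZero:
  fixes P :: "'n::finite tensor"
  assumes egd: "is_egd (P, \<alpha>)" and geo: "geo (SetZero k) (P, \<alpha>) (Q, \<beta>)"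
  shows "y k = 0 \<Longrightarrow> (\<lambda>j. egd_mass (P, \<alpha>) (y(k := j))) sums egd_mass (Q, \<beta>) y"
    and "y k \<noteq> 0 \<Longrightarrow> egd_mass (Q, \<beta>) y = 0"
proof -
  let ?y = "\<lambda>l. min (y l) (tsize P l - 1)"
  let ?r = "\<Prod>l\<in>UNIV - {k}. \<alpha> l ^ (y l + 1 - tsize P l)"
  let ?s = "tsize P k - 1"
  have \<beta>: "\<beta> = \<alpha>(k := 0)"
    using geo by simp
  have r: "(\<Prod>l\<in>UNIV - {k}. \<beta> l ^ (y l + 1 - tsize P l)) = ?r"
    unfolding \<beta> by (rule prod.cong) auto
  \<comment> \<open>The size in direction \<open>k\<close> is 2 and the rate is 0, hence the factor
    \<open>0 ^ (y k - 1)\<close>; every positive \<open>y k\<close> is clipped to index 1, where the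
    entry is 0.\<close>
  have Q: "egd_mass (Q, \<beta>) y = (if min (y k) 1 = 0
            then entry P (?y(k := ?s)) / (1 - \<alpha> k) + (\<Sum>j<?s. entry P (?y(k := j)))
            else 0) * ?r * 0 ^ (y k - 1)"
    unfolding r[symmetric] using geo by (simp add: egd_mass_tensor_upd)
  then show "y k \<noteq> 0 \<Longrightarrow> egd_mass (Q, \<beta>) y = 0"
    by simp
  have ak: "norm (\<alpha> k) < 1"
    using egd by (simp add: is_egd_def)
  have "(\<lambda>i. \<alpha> k ^ i * (entry P (?y(k := ?s)) * ?r)) sums
      (1 / (1 - \<alpha> k) * (entry P (?y(k := ?s)) * ?r))"
    by (intro sums_mult2 geometric_sums ak)
  also have "(\<lambda>i. \<alpha> k ^ i * (entry P (?y(k := ?s)) * ?r)) =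
      (\<lambda>i. egd_mass (P, \<alpha>) (y(k := i + ?s)))"
    using tsize_pos[of P k] by (simp add: fun_eq_iff egd_mass_upd min_absorb2 mult_ac)
  finally have "(\<lambda>j. egd_mass (P, \<alpha>) (y(k := j))) sums
      (1 / (1 - \<alpha> k) * (entry P (?y(k := ?s)) * ?r) + (\<Sum>j<?s. egd_mass (P, \<alpha>) (y(k := j))))"
    by (subst (asm) sums_iff_shift)
  also have "(\<Sum>j<?s. egd_mass (P, \<alpha>) (y(k := j))) = (\<Sum>j<?s. entry P (?y(k := j)) * ?r)"
    by (rule sum.cong) (auto simp: egd_mass_upd min_absorb1)
  finally show "(\<lambda>j. egd_mass (P, \<alpha>) (y(k := j))) sums egd_mass (Q, \<beta>) y" if "y k = 0"
    using that by (simp add: Q sum_distrib_right distrib_right fun_upd_def)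
qed

lemma egd_mass_Incr:
  assumes "geo (Incr k a) (P, \<alpha>) (Q, \<beta>)"
  shows "egd_mass (Q, \<beta>) y = (if y k < a then 0 else egd_mass (P, \<alpha>) (y(k := y k - a)))"
proof -
  let ?y = "\<lambda>l. min (y l) (tsize P l - 1)"
  let ?m = "min (y k) (tsize P k + a - 1)"
  have pos: "1 \<le> tsize P k + a"
    using tsize_pos[of P k] by simp
  have Q: "egd_mass (Q, \<beta>) y = (if ?m < a then 0 else entry P (?y(k := ?m - a)))
     * (\<Prod>l\<in>UNIV - {k}. \<alpha> l ^ (y l + 1 - tsize P l)) * \<alpha> k ^ (y k + 1 - (tsize P k + a))"
    using assms pos by (simp only: geo.simps egd_mass_tensor_upd fun_upd_same fun_upd_upd)
  have "?m < a \<longleftrightarrow> y k < a"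
    using tsize_pos[of P k] by linarith
  moreover have "?m - a = min (y k - a) (tsize P k - 1)"
      "y k + 1 - (tsize P k + a) = y k - a + 1 - tsize P k" if "\<not> y k < a"
    using tsize_pos[of P k] that by linarith+
  ultimately show ?thesis
    by (simp only: Q egd_mass_upd) simp
qed

text \<open>A size of at least 2 separates index 0, where the masses of 0 and 1 merge, from the
  indices that are merely shifted.\<close>

lemma egd_mass_Decr:
  assumes "geo (Decr k) (P, \<alpha>) (Q, \<beta>)"
  shows "egd_mass (Q, \<beta>) y =
    (if y k = 0 then egd_mass (P, \<alpha>) (y(k := 0)) + egd_mass (P, \<alpha>) (y(k := 1))
     else egd_mass (P, \<alpha>) (y(k := y k + 1)))"
proof -
  let ?y = "\<lambda>l. min (y l) (tsize P l - 1)"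
  let ?n = "max (tsize P k - 1) 2"
  let ?m = "min (y k) (?n - 1)"
  let ?r = "\<Prod>l\<in>UNIV - {k}. \<alpha> l ^ (y l + 1 - tsize P l)"
  have "1 \<le> ?n"
    by simp
  then have Q: "egd_mass (Q, \<beta>) y =
      (if ?m = 0
       then entry P (?y(k := 0))
            + entry P (?y(k := min (tsize P k - 1) 1)) * \<alpha> k ^ (2 - tsize P k)
       else entry P (?y(k := min (tsize P k - 1) (?m + 1))) * \<alpha> k ^ (?m + 2 - tsize P k))
      * ?r * \<alpha> k ^ (y k + 1 - ?n)"
    using assms by (simp only: geo.simps egd_mass_tensor_upd fun_upd_same fun_upd_upd)
  show ?thesis
  proof (cases "y k = 0")
    case True
    then show ?thesis
      using tsize_pos[of P k]
      by (simp add: Q egd_mass_upd distrib_right min.commute numeral_2_eq_2)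
  next
    case False
    have "?m \<noteq> 0"
      using False by simp
    moreover have "min (tsize P k - 1) (?m + 1) = min (y k + 1) (tsize P k - 1)"
      by linarith
    \<comment> \<open>Part of the decay sits in the entry at \<open>?m\<close>, the rest in the tail
      beyond the new size; together they give the decay at \<open>y k + 1\<close>.\<close>
    moreover have "(?m + 2 - tsize P k) + (y k + 1 - ?n) = y k + 1 + 1 - tsize P k"
      using tsize_pos[of P k] by linarith
    then have pow: "\<alpha> k ^ (?m + 2 - tsize P k) * \<alpha> k ^ (y k + 1 - ?n) = \<alpha> k ^ (y k + 1 + 1 - tsize P k)"
      by (simp only: flip: power_add)
    ultimately have "egd_mass (Q, \<beta>) y = entry P (?y(k := min (y k + 1) (tsize P k - 1)))
        * ?r * \<alpha> k ^ (y k + 1 + 1 - tsize P k)"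
      by (simp only: Q if_False mult_ac flip: pow)
    then show ?thesis
      using False by (simp only: egd_mass_upd if_False)
  qed
qed

primrec primitive :: "'n prog \<Rightarrow> bool" where
  "primitive Skip \<longleftrightarrow> True"
| "primitive (Seq P1 P2) \<longleftrightarrow> False"
| "primitive (SetZero k) \<longleftrightarrow> True"
| "primitive (Incr k a) \<longleftrightarrow> True"
| "primitive (Decr k) \<longleftrightarrow> True"
| "primitive (IfElse E P1 P2) \<longleftrightarrow> False"
| "primitive (While E B) \<longleftrightarrow> False"
| "primitive Fail \<longleftrightarrow> True"

lemma geo_primitive_total:
  assumes "primitive C"
  obtains F where "geo C D F"
  using assms by (cases C; cases D) (auto simp: geo_Skip intro: that)

lemma push_emass:
  assumes "finite (h -` {y})" "\<And>x. 0 \<le> egd_mass D x"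
  shows "push h (emass D) y = ennreal (\<Sum>x\<in>h -` {y}. egd_mass D x)"
  using assms by (simp add: push_def nn_integral_count_space_finite)

lemma geo_primitive_exact:
  fixes D :: "'n::finite egd"
  assumes C: "primitive C" "geo C D F" and egd: "is_egd D"
  shows "is_egd F" and "emass F = denot C (emass D)"
proof -
  obtain P \<alpha> Q \<beta> where D: "D = (P, \<alpha>)" "F = (Q, \<beta>)"
    by (cases D, cases F) auto
  have nn: "0 \<le> egd_mass D x" for x
    using egd by (rule egd_mass_nonneg)
  have \<beta>: "0 \<le> \<beta> k \<and> \<beta> k < 1" for k
    using C egd by (cases C) (auto simp: D is_egd_def)
  have "0 \<le> egd_mass F y \<and> emass F y = denot C (emass D) y" for y
  proof (cases C)
    case Skip
    then show ?thesis
      using C nn by (simp add: geo_Skip)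
  next
    case (SetZero k)
    note QS = egd_mass_SetZero[OF egd[unfolded D] C(2)[unfolded D SetZero], of y, folded D]
    show ?thesis
    proof (cases "y k = 0")
      case True
      \<comment> \<open>The fibre over \<open>y\<close> is the line in direction \<open>k\<close>,
        indexed by the old value of the variable.\<close>
      have "bij_betw (\<lambda>j. y(k := j)) UNIV ((\<lambda>x. x(k := 0)) -` {y})"
        using True by (intro bij_betwI[where g = "\<lambda>x. x k"]) (auto simp: fun_upd_idem)
      then have "push (\<lambda>x. x(k := 0)) (emass D) y = (\<integral>\<^sup>+j. emass D (y(k := j)) \<partial>count_space UNIV)"
        unfolding push_def by (rule nn_integral_bij_count_space[symmetric])
      also have "\<dots> = (\<Sum>j. emass D (y(k := j)))"
        by (rule nn_integral_count_space_nat)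
      also have "\<dots> = emass F y"
        using QS(1)[OF True] nn by (subst suminf_ennreal2) (auto simp: sums_iff)
      finally have "emass F y = denot C (emass D) y"
        using SetZero by simp
      moreover have "0 \<le> egd_mass F y"
        using QS(1)[OF True] nn by (metis sums_iff suminf_nonneg)
      ultimately show ?thesis by simp
    next
      case False
      then have "(\<lambda>x. x(k := 0)) -` {y} = {}"
        by auto
      then show ?thesis
        using QS(2)[OF False] SetZero by (simp add: push_def nn_integral_empty)
    qed
  next
    case (Incr k a)
    have "(\<lambda>x. x(k := x k + a)) -` {y} = (if y k < a then {} else {y(k := y k - a)})"
      by (force simp: fun_upd_idem_iff)
    then show ?thesis
      using egd_mass_Incr[OF C(2)[unfolded D Incr], of y, folded D] nn Incr
      by (auto simp: push_emass)
  next
    case (Decr k)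
    have "(\<lambda>x. x(k := x k - 1)) -` {y} =
      (if y k = 0 then {y(k := 0), y(k := 1)} else {y(k := y k + 1)})"
      by (auto simp: fun_eq_iff split: if_splits)
    moreover have "y(k := 0) \<noteq> y(k := 1)"
      by (metis fun_upd_same zero_neq_one)
    ultimately show ?thesis
      using egd_mass_Decr[OF C(2)[unfolded D Decr], of y, folded D] nn Decr
      by (auto simp: push_emass)
  next
    case Fail
    then show ?thesis
      using C by (simp add: D egd_mass_tensor)
  qed (use C in auto)
  then show "is_egd F" "emass F = denot C (emass D)"
    using \<beta> by (auto simp: D intro: is_egdI_mass)
qed


lemma geo_primitive_sound:
  assumes "primitive C" "geo C D F" "is_egd D"
  shows "denot C (emass D) y \<le> emass F y"
  using geo_primitive_exact(2)[OF assms] by (simp add: fun_eq_iff)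

section \<open>Soundness for loops and composed programs\<close>

lemma emass_mono: "(\<And>x. egd_mass D x \<le> c * egd_mass F x) \<Longrightarrow> 0 \<le> c \<Longrightarrow>
    emass D x \<le> ennreal c * emass F x"
  by (metis ennreal_leI ennreal_mult')

lemma While_mass:
  fixes R S F :: "'n::finite egd"
  assumes c: "0 \<le> c" "c < 1" and F: "geo_restr (ENot E) (tscale (1 / (1 - c)) (fst R), snd R) = F"
  shows "snd F = snd R" "egd_mass F x = weight (ENot E) x * egd_mass R x / (1 - c)"
  using F[symmetric]
  by (simp_all add: snd_geo_restr egd_mass_geo_restr egd_mass_tscale del: geo_restr.simps)

text \<open>By linearity, \<open>n\<close> rounds started from the invariant \<open>R\<close> leave
  at most \<open>c ^ n\<close> times \<open>R\<close>, so the exits form a geometric series whose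
  total \<open>1 / (1 - c)\<close> is the scaling in \<open>F\<close>. The body estimate is a
  hypothesis because both the soundness induction and the analysis of unrolled loops use the
  lemma.\<close>

lemma denot_While_le:
  fixes R S :: "'n::finite egd"
  assumes E: "wf_event E" and c: "0 \<le> c" "c < 1"
    and F: "geo_restr (ENot E) (tscale (1 / (1 - c)) (fst R), snd R) = F"
    and body: "\<And>y. denot B (emass (geo_restr E R)) y \<le> emass S y"
    and S: "\<And>x. egd_mass S x \<le> c * egd_mass R x"
  shows "denot (While E B) (emass R) y \<le> emass F y"
proof -
  let ?T = "\<lambda>f. denot B (reweight E f)"
  have T: "?T (emass R) y \<le> ennreal c * emass R y" for y
    using body[of y] emass_mono[OF S c(1), of y] E by (simp add: emass_geo_restr)
  have "(?T ^^ n) (emass R) y \<le> ennreal (c ^ n) * emass R y" for n y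
  proof (induction n arbitrary: y)
    case (Suc n)
    have "?T ((?T ^^ n) (emass R)) y \<le> ?T (\<lambda>x. ennreal (c ^ n) * emass R x) y"
      using Suc by (intro denot_mono reweight_mono)
    also have "\<dots> = ennreal (c ^ n) * ?T (emass R) y"
      by (simp add: reweight_cmult denot_cmult)
    also have "\<dots> \<le> ennreal (c ^ n) * (ennreal c * emass R y)"
      by (intro mult_left_mono T) simp
    also have "\<dots> = ennreal (c ^ Suc n) * emass R y"
      using c by (simp add: ennreal_mult mult_ac)
    finally show ?case
      by simp
  qed simp
  then have "denot (While E B) (emass R) y
      \<le> (\<Sum>n. reweight (ENot E) (\<lambda>x. ennreal (c ^ n) * emass R x) y)"
    by (auto intro!: suminf_le reweight_mono)
  also have "\<dots> = (\<Sum>n. ennreal (c ^ n)) * reweight (ENot E) (emass R) y"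
    by (simp add: reweight_cmult)
  also have "(\<Sum>n. ennreal (c ^ n)) = ennreal (1 / (1 - c))"
    using c by (subst suminf_ennreal2) (auto simp: suminf_geometric summable_geometric)
  also have "ennreal (1 / (1 - c)) * reweight (ENot E) (emass R) y = emass F y"
    using c weight_bounds[of "ENot E" y] E
    by (simp add: While_mass(2)[OF c F] reweight_def flip: ennreal_mult')
  finally show ?thesis .
qed

text \<open>Needed in two places: for the unrolled program it gives the lower estimate, and for
  parts of the given program it limits how errors propagate through what follows.\<close>

lemma geo_sound:
  fixes D F :: "'n::finite egd"
  assumes "wf_prog P" "is_egd D" "is_egd F" "geo P D F"
  shows "denot P (emass D) y \<le> emass F y"
  using assms
proof (induction P arbitrary: D F y)
  case (Seq P1 P2)
  then obtain R where R: "is_egd R" "geo P1 D R" "geo P2 R F"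
    by (auto simp: geo_Seq)
  have "denot P2 (denot P1 (emass D)) y \<le> denot P2 (emass R) y"
    using Seq R by (intro denot_mono) auto
  also have "\<dots> \<le> emass F y"
    using Seq R by auto
  finally show ?case
    by simp
next
  case (IfElse E P1 P2)
  then obtain R S where RS: "is_egd R" "is_egd S" "geo P1 (geo_restr E D) R"
    "geo P2 (geo_restr (ENot E) D) S" "(R, S, F) \<in> Join"
    by (auto simp: geo_IfElse)
  have E: "wf_event E" "wf_event (ENot E)"
    using IfElse by auto
  have "denot P1 (emass (geo_restr E D)) y \<le> emass R y"
    using IfElse RS E by (intro IfElse.IH is_egd_geo_restr) auto
  moreover have "denot P2 (emass (geo_restr (ENot E) D)) y \<le> emass S y"
    using IfElse RS E by (intro IfElse.IH is_egd_geo_restr) auto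
  moreover have "emass R y + emass S y \<le> emass F y"
    using Join_mass_le[OF RS(5,1,2), of y] IfElse RS
    by (simp add: egd_mass_nonneg ennreal_leI flip: ennreal_plus)
  ultimately show ?case
    unfolding emass_geo_restr[OF E(1)] emass_geo_restr[OF E(2)]
    by (auto intro: order_trans add_mono)
next
  case (While E B)
  then obtain c R S where RS: "0 \<le> c" "c < 1" "is_egd R" "is_egd S" "D \<preceq>\<^sub>E R"
    "geo B (geo_restr E R) S" "S \<preceq>\<^sub>E (tscale c (fst R), snd R)"
    and F: "geo_restr (ENot E) (tscale (1 / (1 - c)) (fst R), snd R) = F"
    by (auto simp: geo_While simp del: geo_restr.simps)
  have E: "wf_event E"
    using While by simp
  have S: "egd_mass S x \<le> c * egd_mass R x" for x
    using RS egd_le_iff[OF RS(4) is_egd_tscale[of "fst R" "snd R" c]] by (simp add: egd_mass_tscale)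
  \<comment> \<open>The loop is entered with \<open>D\<close>, but the contraction is known only for
    the invariant \<open>R\<close>; monotonicity replaces one by the other.\<close>
  have "denot (While E B) (emass D) y \<le> denot (While E B) (emass R) y"
    using RS egd_le_iff[OF While.prems(2) RS(3)] by (intro denot_mono ennreal_leI) auto
  also have "\<dots> \<le> emass F y"
    using While RS E
    by (intro denot_While_le[OF E RS(1,2) F _ S] While.IH is_egd_geo_restr) auto
  finally show ?case .
qed (auto intro!: geo_primitive_sound simp del: geo.simps denot.simps)

section \<open>Convergence of the unrolled bounds\<close>

text \<open>
  The error estimate for \<open>P\<^sub>1;P\<^sub>2\<close> and for loops applies the estimate of the second program to
  initial bounds that depend on \<open>u\<close>. Hence the claim is made uniformly for all initial bounds
  below a multiple of the given one, with the error relative to that multiple.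
\<close>

definition below :: "real \<Rightarrow> 'n::finite egd \<Rightarrow> 'n egd \<Rightarrow> bool" where
  "below t D' D \<longleftrightarrow> is_egd D' \<and> (\<forall>k. snd D' k \<le> snd D k) \<and>
     (\<forall>x. egd_mass D' x \<le> t * egd_mass D x)"

text \<open>Equality of rates can be promised only for equal initial rates, because
  \<open>Skip\<close> and other atomic statements pass the initial rates on. Branches and loops need
  from their parts only the inequality contained in \<open>below\<close>.\<close>

definition unroll_approx :: "nat \<Rightarrow> 'n::finite prog \<Rightarrow> 'n egd \<Rightarrow> 'n egd \<Rightarrow> real \<Rightarrow> bool" where
  "unroll_approx u P D F e \<longleftrightarrow>
     (\<forall>t D'. 0 \<le> t \<longrightarrow> below t D' D \<longrightarrow>
       (\<exists>F'. geo (unroll u P) D' F' \<and> below t F' F \<and> (snd D' = snd D \<longrightarrow> snd F' = snd F) \<and>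
          (\<forall>y. emass F' y \<le> denot P (emass D') y + ennreal (t * e) * emass F y)))"

lemma unroll_approxE:
  assumes "unroll_approx u P D F e" "0 \<le> t" "below t D' D"
  obtains F' where "geo (unroll u P) D' F'" "below t F' F" "snd D' = snd D \<Longrightarrow> snd F' = snd F"
    "\<And>y. emass F' y \<le> denot P (emass D') y + ennreal (t * e) * emass F y"
  using assms unfolding unroll_approx_def by blast

lemma unroll_approx_mono:
  assumes "unroll_approx u P D F e" "e \<le> e'"
  shows "unroll_approx u P D F e'"
  unfolding unroll_approx_def
proof (intro allI impI)
  fix t :: real and D' assume t: "0 \<le> t" "below t D' D"
  then obtain F' where F': "geo (unroll u P) D' F'" "below t F' F" "snd D' = snd D \<Longrightarrow> snd F' = snd F"
    "\<And>y. emass F' y \<le> denot P (emass D') y + ennreal (t * e) * emass F y"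
    using unroll_approxE[OF assms(1)] by metis
  have "denot P (emass D') y + ennreal (t * e) * emass F y
      \<le> denot P (emass D') y + ennreal (t * e') * emass F y" for y
    using t assms(2) by (intro add_left_mono mult_right_mono ennreal_leI mult_left_mono) auto
  then show "\<exists>F'. geo (unroll u P) D' F' \<and> below t F' F \<and> (snd D' = snd D \<longrightarrow> snd F' = snd F) \<and>
          (\<forall>y. emass F' y \<le> denot P (emass D') y + ennreal (t * e') * emass F y)"
    using F' order_trans by blast
qed

lemma below_emass: "below t D' D \<Longrightarrow> 0 \<le> t \<Longrightarrow> emass D' x \<le> ennreal t * emass D x"
  by (rule emass_mono) (auto simp: below_def)

lemma below_geo_restr:
  assumes "below t D' D" "is_egd D" "wf_event E"
  shows "below t (geo_restr E D') (geo_restr E D)"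
  using assms snd_geo_restr_mono[of D' D] is_egd_geo_restr[of D' E]
    mult_left_mono[of "egd_mass D' x" "t * egd_mass D x" "weight E x" for x] weight_bounds[of E]
  by (simp add: below_def egd_mass_geo_restr mult.left_commute)

text \<open>Exactness and linearity turn an initial bound below \<open>t\<close> times
  \<open>D\<close> into one below \<open>t\<close> times \<open>F\<close>, without any
  error.\<close>

lemma unroll_approx_primitive:
  fixes D F :: "'n::finite egd"
  assumes P: "primitive P" and geo: "geo P D F" and egd: "is_egd D"
  shows "unroll_approx u P D F 0"
  unfolding unroll_approx_def
proof (intro allI impI)
  fix t :: real and D' :: "'n egd" assume t: "0 \<le> t" "below t D' D"
  obtain F' where F': "geo P D' F'"
    using geo_primitive_total[OF P] .
  have D': "is_egd D'"
    using t by (simp add: below_def)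
  note exact = geo_primitive_exact[OF P F' D'] geo_primitive_exact[OF P geo egd]
  have "emass F' y \<le> ennreal t * emass F y" for y
    using denot_le_cmult[of "emass D'" "ennreal t" "emass D" P y] below_emass[OF t(2,1)]
    by (simp flip: exact(2) exact(4))
  then have "egd_mass F' y \<le> t * egd_mass F y" for y
    using t(1) exact(3) by (simp add: egd_mass_nonneg flip: ennreal_mult)
  moreover have "snd F' k \<le> snd F k \<and> (snd D' = snd D \<longrightarrow> snd F' = snd F)" for k
    using t P F' geo by (cases P; cases D; cases F; cases D'; cases F') (auto simp: below_def)
  moreover have "unroll u P = P"
    using P by (cases P) auto
  ultimately show "\<exists>F'. geo (unroll u P) D' F' \<and> below t F' F \<and> (snd D' = snd D \<longrightarrow> snd F' = snd F) \<and>
          (\<forall>y. emass F' y \<le> denot P (emass D') y + ennreal (t * 0) * emass F y)"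
    using F' exact(1) by (intro exI[of _ F']) (simp add: below_def flip: exact(2))
qed

text \<open>The error of the first program is at most \<open>t * e1\<close> times \<open>R\<close>;
  linearity carries it through the second one, and soundness bounds the image of \<open>R\<close> by
  \<open>F\<close>. Hence the errors add.\<close>

lemma unroll_approx_Seq:
  fixes D R F :: "'n::finite egd"
  assumes P1: "unroll_approx u P1 D R e1" and P2: "unroll_approx u P2 R F e2"
    and e: "0 \<le> e1" "0 \<le> e2"
    and sound: "\<And>y. denot P2 (emass R) y \<le> emass F y"
  shows "unroll_approx u (Seq P1 P2) D F (e1 + e2)"
  unfolding unroll_approx_def
proof (intro allI impI)
  fix t :: real and D' :: "'n egd" assume t: "0 \<le> t" "below t D' D"
  obtain R' where R': "geo (unroll u P1) D' R'" "below t R' R" "snd D' = snd D \<Longrightarrow> snd R' = snd R"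
    "\<And>y. emass R' y \<le> denot P1 (emass D') y + ennreal (t * e1) * emass R y"
    using unroll_approxE[OF P1 t] by metis
  obtain F' where F': "geo (unroll u P2) R' F'" "below t F' F" "snd R' = snd R \<Longrightarrow> snd F' = snd F"
    "\<And>y. emass F' y \<le> denot P2 (emass R') y + ennreal (t * e2) * emass F y"
    using unroll_approxE[OF P2 t(1) R'(2)] by metis
  have "emass F' y \<le> denot (Seq P1 P2) (emass D') y + ennreal (t * (e1 + e2)) * emass F y" for y
  proof -
    have "denot P2 (emass R') y
        \<le> denot P2 (\<lambda>x. denot P1 (emass D') x + ennreal (t * e1) * emass R x) y"
      by (intro denot_mono R')
    also have "\<dots> = denot P2 (denot P1 (emass D')) y + ennreal (t * e1) * denot P2 (emass R) y"
      by (simp add: denot_add denot_cmult)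
    also have "\<dots> \<le> denot P2 (denot P1 (emass D')) y + ennreal (t * e1) * emass F y"
      by (intro add_left_mono mult_left_mono sound) simp
    finally have "emass F' y \<le> denot P2 (denot P1 (emass D')) y + ennreal (t * e1) * emass F y
        + ennreal (t * e2) * emass F y"
      using F'(4)[of y] by (meson add_right_mono order_trans)
    also have "\<dots> = denot (Seq P1 P2) (emass D') y + ennreal (t * (e1 + e2)) * emass F y"
      using e t by (simp add: add.assoc distrib_left flip: distrib_right)
    finally show ?thesis .
  qed
  moreover have "is_egd R'"
    using R' by (simp add: below_def)
  ultimately show "\<exists>F'. geo (unroll u (Seq P1 P2)) D' F' \<and> below t F' F \<and>
      (snd D' = snd D \<longrightarrow> snd F' = snd F) \<and>
      (\<forall>y. emass F' y \<le> denot (Seq P1 P2) (emass D') y + ennreal (t * (e1 + e2)) * emass F y)"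
    using R' F' by (intro exI[of _ F']) (auto simp: geo_Seq simp del: split_paired_Ex)
qed

text \<open>The additional \<open>\<epsilon>\<close> covers the decay rates that are increased by the join.\<close>

lemma below_Join:
  fixes R' S' F :: "'n::finite egd"
  assumes egd: "is_egd R'" "is_egd S'" "is_egd F"
    and exps: "\<And>k. snd R' k \<le> snd F k" "\<And>k. snd S' k \<le> snd F k"
    and bound: "\<And>x. egd_mass R' x + egd_mass S' x \<le> t * egd_mass F x"
    and t: "0 \<le> t" and \<epsilon>: "0 < \<epsilon>"
  obtains F' where "(R', S', F') \<in> Join" "snd F' = snd F" "below t F' F"
    "\<And>x. emass F' x \<le> emass R' x + emass S' x + ennreal (t * \<epsilon>) * emass F x"
proof -
  obtain Q where Q: "(R', S', (Q, snd F)) \<in> Join" "is_egd (Q, snd F)"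
    "(Q, snd F) \<preceq>\<^sub>E (tscale t (fst F), snd F)"
    "\<And>x. egd_mass (Q, snd F) x \<le> egd_mass R' x + egd_mass S' x
        + \<epsilon> * egd_mass (tscale t (fst F), snd F) x"
    using Join_approx[OF egd(1,2) is_egd_tscale[of "fst F" "snd F" t] exps] egd(3) t \<epsilon> bound
    by (auto simp: egd_mass_tscale)
  have "below t (Q, snd F) F"
    using Q(3) egd_le_iff[OF Q(2) is_egd_tscale[of "fst F" "snd F" t]] Q(2) egd(3) t
    by (simp add: below_def egd_mass_tscale)
  moreover have "emass (Q, snd F) x \<le> emass R' x + emass S' x + ennreal (t * \<epsilon>) * emass F x" for x
  proof -
    have "emass (Q, snd F) x \<le> ennreal (egd_mass R' x + egd_mass S' x + t * \<epsilon> * egd_mass F x)"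
      using Q(4)[of x] by (intro ennreal_leI) (simp add: egd_mass_tscale mult_ac)
    also have "\<dots> = emass R' x + emass S' x + ennreal (t * \<epsilon>) * emass F x"
      using egd t \<epsilon> by (simp add: egd_mass_nonneg ennreal_mult mult.assoc)
    finally show ?thesis .
  qed
  ultimately show ?thesis
    using Q(1) by (intro that) auto
qed

text \<open>The branch errors are relative to \<open>R\<close> and \<open>S\<close>, which lie below
  \<open>F\<close> by the given join, so they add up relative to \<open>F\<close>; the new join
  costs \<epsilon>.\<close>

lemma unroll_approx_IfElse:
  fixes D R S F :: "'n::finite egd"
  assumes egd: "is_egd D" "is_egd R" "is_egd S" "is_egd F" and E: "wf_event E"
    and P1: "unroll_approx u P1 (geo_restr E D) R e1"
    and P2: "unroll_approx u P2 (geo_restr (ENot E) D) S e2"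
    and J: "(R, S, F) \<in> Join"
    and e: "0 \<le> e1" "0 \<le> e2" "0 < \<epsilon>"
  shows "unroll_approx u (IfElse E P1 P2) D F (e1 + e2 + \<epsilon>)"
  unfolding unroll_approx_def
proof (intro allI impI)
  fix t :: real and D' :: "'n egd" assume t: "0 \<le> t" "below t D' D"
  have E': "wf_event (ENot E)"
    using E by simp
  obtain R' where R': "geo (unroll u P1) (geo_restr E D') R'" "below t R' R"
    "\<And>y. emass R' y \<le> denot P1 (emass (geo_restr E D')) y + ennreal (t * e1) * emass R y"
    using unroll_approxE[OF P1 t(1) below_geo_restr[OF t(2) egd(1) E]] by metis
  obtain S' where S': "geo (unroll u P2) (geo_restr (ENot E) D') S'" "below t S' S"
    "\<And>y. emass S' y \<le> denot P2 (emass (geo_restr (ENot E) D')) y + ennreal (t * e2) * emass S y"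
    using unroll_approxE[OF P2 t(1) below_geo_restr[OF t(2) egd(1) E']] by metis
  have le: "egd_mass R x + egd_mass S x \<le> egd_mass F x" for x
    by (rule Join_mass_le[OF J egd(2-4)])
  have le': "emass R x \<le> emass F x" "emass S x \<le> emass F x" for x
    using le[of x] egd_mass_nonneg[OF egd(2), of x] egd_mass_nonneg[OF egd(3), of x]
    by (auto intro: ennreal_leI)
  have exps: "snd R k \<le> snd F k" "snd S k \<le> snd F k" for k
    using J by (auto simp: Join_def)
  obtain F' where F': "(R', S', F') \<in> Join" "snd F' = snd F" "below t F' F"
    "\<And>x. emass F' x \<le> emass R' x + emass S' x + ennreal (t * \<epsilon>) * emass F x"
  proof (rule below_Join[OF _ _ egd(4) _ _ _ t(1) e(3)])
    show "is_egd R'" "is_egd S'"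
      using R'(2) S'(2) by (simp_all add: below_def)
    show "snd R' k \<le> snd F k" "snd S' k \<le> snd F k" for k
      using R'(2) S'(2) exps(1,2)[of k] order_trans unfolding below_def by blast+
    show "egd_mass R' x + egd_mass S' x \<le> t * egd_mass F x" for x
    proof -
      have "egd_mass R' x \<le> t * egd_mass R x" "egd_mass S' x \<le> t * egd_mass S x"
        using R'(2) S'(2) by (simp_all add: below_def)
      then show ?thesis
        using mult_left_mono[OF le[of x] t(1)] by (simp add: distrib_left)
    qed
  qed blast
  have "emass F' y \<le> denot (IfElse E P1 P2) (emass D') y + ennreal (t * (e1 + e2 + \<epsilon>)) * emass F y"
    for y
  proof -
    have "emass R' y \<le> denot P1 (reweight E (emass D')) y + ennreal (t * e1) * emass F y"
      unfolding emass_geo_restr[OF E, symmetric]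
      by (rule order_trans[OF R'(3)]) (intro add_left_mono mult_left_mono le'; simp)
    moreover have "emass S' y \<le> denot P2 (reweight (ENot E) (emass D')) y + ennreal (t * e2) * emass F y"
      unfolding emass_geo_restr[OF E', symmetric]
      by (rule order_trans[OF S'(3)]) (intro add_left_mono mult_left_mono le'; simp)
    ultimately have "emass F' y \<le> (denot P1 (reweight E (emass D')) y + ennreal (t * e1) * emass F y)
        + (denot P2 (reweight (ENot E) (emass D')) y + ennreal (t * e2) * emass F y)
        + ennreal (t * \<epsilon>) * emass F y"
      by (intro order_trans[OF F'(4)] add_right_mono add_mono)
    also have "\<dots> = denot (IfElse E P1 P2) (emass D') y + ennreal (t * (e1 + e2 + \<epsilon>)) * emass F y"
      using e t by (simp add: distrib_left distrib_right add_ac)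
    finally show ?thesis .
  qed
  moreover have "is_egd R'" "is_egd S'"
    using R' S' by (auto simp: below_def)
  ultimately show "\<exists>F'. geo (unroll u (IfElse E P1 P2)) D' F' \<and> below t F' F \<and>
      (snd D' = snd D \<longrightarrow> snd F' = snd F) \<and>
      (\<forall>y. emass F' y \<le> denot (IfElse E P1 P2) (emass D') y
         + ennreal (t * (e1 + e2 + \<epsilon>)) * emass F y)"
    using R' S' F' by (intro exI[of _ F'])
      (auto simp: geo_IfElse simp del: geo_restr.simps split_paired_Ex)
qed

text \<open>From an initial bound below \<open>t * R\<close> the body leaves one below
  \<open>c * t * R\<close>, so the scale drops by \<open>c\<close> per unrolled iteration. After
  \<open>u\<close> iterations the remaining loop is bounded crudely by the scaled \<open>F\<close>,
  which costs \<open>c ^ u\<close>; the errors of bodies and joins total at most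
  \<open>(e + \<epsilon>) / (1 - c)\<close>.\<close>

lemma unroll_approx_While:
  fixes D R S F :: "'n::finite egd"
  assumes egd: "is_egd D" "is_egd R" "is_egd S" and E: "wf_event E"
    and c: "0 \<le> c" "c < 1"
    and DR: "below 1 D R"
    and B: "unroll_approx u B (geo_restr E R) S e"
    and sound: "\<And>y. denot B (emass (geo_restr E R)) y \<le> emass S y"
    and SR: "below c S R"
    and F: "geo_restr (ENot E) (tscale (1 / (1 - c)) (fst R), snd R) = F"
    and e: "0 \<le> e" "0 < \<epsilon>"
  shows "unroll_approx u (While E B) D F (c ^ u + (e + \<epsilon>) / (1 - c))"
proof -
  let ?W = "denot (While E B)"
  \<comment> \<open>The solution of \<open>X = c * X + e + \<epsilon>\<close>: an error budget that
    one more unrolled iteration reproduces.\<close>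
  define X where "X = (e + \<epsilon>) / (1 - c)"
  have E': "wf_event (ENot E)"
    using E by simp
  have sndF: "snd F = snd R" and massF: "\<And>x. (1 - c) * egd_mass F x = weight (ENot E) x * egd_mass R x"
    using While_mass[OF c F] c by simp_all
  have egdF: "is_egd F"
    unfolding F[symmetric] using egd(2) c E' by (intro is_egd_geo_restr is_egd_tscale) auto
  have X: "0 \<le> X" "(1 - c) * X = e + \<epsilon>"
    using e c by (simp_all add: X_def)
  have "?W (emass R) y \<le> emass F y" for y
    using SR by (intro denot_While_le[OF E c F sound]) (simp add: below_def)
  then have WS: "?W (emass S) y \<le> ennreal c * emass F y" for y
    using denot_le_cmult[of "emass S" "ennreal c" "emass R" "While E B" y] below_emass[OF SR c(1)]
    by (meson mult_left_mono order_trans zero_le)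
  have loop: "\<exists>F'. geo (unroll_loop E (unroll u B) u v) D' F' \<and> below t F' F \<and> snd F' = snd F \<and>
      (\<forall>y. emass F' y \<le> ?W (emass D') y + ennreal (t * (c ^ (u - v) + X)) * emass F y)"
    if "0 \<le> t" "below t D' R" for t v D'
    using that
  proof (induction "u - v" arbitrary: t v D')
    case 0
    \<comment> \<open>No iteration is left to unroll. The scaled invariant \<open>t * R\<close>
      satisfies the loop rule with the same factor \<open>c\<close>; the body is bounded from
      \<open>R'\<close>, not from \<open>D'\<close>, as that rule demands.\<close>
    define R' where "R' = (tscale t (fst R), snd R)"
    have R': "is_egd R'" "below t R' R" "below 1 D' R'"
      using 0 is_egd_tscale[of "fst R" "snd R" t] egd by (auto simp: R'_def below_def egd_mass_tscale)
    obtain S' where S': "geo (unroll u B) (geo_restr E R') S'" "below t S' S"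
      using unroll_approxE[OF B 0(2) below_geo_restr[OF R'(2) egd(2) E]] by metis
    define F' where "F' = geo_restr (ENot E) (tscale (1 / (1 - c)) (fst R'), snd R')"
    have egdF': "is_egd F'"
      unfolding F'_def using R'(1) c E' by (intro is_egd_geo_restr is_egd_tscale) auto
    have sndF': "snd F' = snd F" and massF': "egd_mass F' x = t * egd_mass F x" for x
      using While_mass[OF c F'_def[symmetric]] While_mass[OF c F]
      by (simp_all add: R'_def egd_mass_tscale)
    have "D' \<preceq>\<^sub>E R'"
      using R' 0 by (subst egd_le_iff) (auto simp: below_def)
    moreover have "S' \<preceq>\<^sub>E (tscale c (fst R'), snd R')"
    proof (subst egd_le_iff)
      have "egd_mass S' x \<le> c * (t * egd_mass R x)" for x
      proof -
        have "egd_mass S' x \<le> t * egd_mass S x"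
          using S' by (simp add: below_def)
        also have "\<dots> \<le> t * (c * egd_mass R x)"
          using SR 0 by (intro mult_left_mono) (auto simp: below_def)
        finally show ?thesis
          by (simp add: mult_ac)
      qed
      moreover have "snd S' k \<le> snd R k" for k
        using S'(2) SR unfolding below_def by (meson order_trans)
      ultimately show "(\<forall>k. snd S' k \<le> snd (tscale c (fst R'), snd R') k) \<and>
          (\<forall>x. egd_mass S' x \<le> egd_mass (tscale c (fst R'), snd R') x)"
        by (simp add: R'_def egd_mass_tscale)
    qed (use S' R' c in \<open>auto simp: below_def intro: is_egd_tscale\<close>)
    moreover have "is_egd S'"
      using S' by (simp add: below_def)
    ultimately have "geo (While E (unroll u B)) D' F'"
      unfolding geo_While F'_def using R' S' c by blast
    moreover have "unroll_loop E (unroll u B) u v = While E (unroll u B)"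
      using 0(1) by (subst unroll_loop.simps) simp
    moreover have "emass F' y \<le> ?W (emass D') y + ennreal (t * (c ^ (u - v) + X)) * emass F y" for y
    proof -
      \<comment> \<open>Here \<open>c ^ (u - v) = 1\<close>, so the whole bound \<open>t * F\<close>
        may count as error.\<close>
      have "emass F' y = ennreal (t * 1) * emass F y"
        using 0 by (simp add: massF' ennreal_mult')
      also have "\<dots> \<le> ennreal (t * (c ^ (u - v) + X)) * emass F y"
        using 0 X by (intro mult_right_mono ennreal_leI mult_left_mono) auto
      finally show ?thesis
        by (rule order_trans) simp
    qed
    ultimately show ?case
      using egdF' sndF' massF' by (intro exI[of _ F']) (simp add: below_def)
  next
    case (Suc d)
    have d: "d = u - (v + 1)" "v < u" "u - v = Suc d"
      using Suc(2) by auto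
    have ct: "0 \<le> c * t"
      using c Suc by simp
    obtain S' where S': "geo (unroll u B) (geo_restr E D') S'" "below t S' S"
      "\<And>y. emass S' y \<le> denot B (emass (geo_restr E D')) y + ennreal (t * e) * emass S y"
      using unroll_approxE[OF B Suc(3) below_geo_restr[OF Suc(4) egd(2) E]] by metis
    have "below (c * t) S' R"
      unfolding below_def
    proof (intro conjI allI)
      fix x
      have "egd_mass S' x \<le> t * egd_mass S x"
        using S' by (simp add: below_def)
      also have "\<dots> \<le> t * (c * egd_mass R x)"
        using SR Suc by (intro mult_left_mono) (auto simp: below_def)
      finally show "egd_mass S' x \<le> c * t * egd_mass R x"
        by (simp add: mult_ac)
    next
      show "snd S' k \<le> snd R k" for k
        using S'(2) SR unfolding below_def by (meson order_trans)
    qed (use S' in \<open>simp add: below_def\<close>)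
    from Suc(1)[OF d(1) ct this] obtain F1 where F1:
      "geo (unroll_loop E (unroll u B) u (v + 1)) S' F1" "below (c * t) F1 F" "snd F1 = snd F"
      "\<And>y. emass F1 y \<le> ?W (emass S') y + ennreal (c * t * (c ^ d + X)) * emass F y"
      unfolding d(1)[symmetric] by blast
    let ?G = "geo_restr (ENot E) D'"
    have G: "below t ?G (geo_restr (ENot E) R)"
      by (rule below_geo_restr[OF Suc(4) egd(2) E'])
    obtain F' where F': "(F1, ?G, F') \<in> Join" "snd F' = snd F" "below t F' F"
      "\<And>x. emass F' x \<le> emass F1 x + emass ?G x + ennreal (t * \<epsilon>) * emass F x"
    proof (rule below_Join[OF _ _ egdF _ _ _ Suc(3) e(2)])
      show "is_egd F1" "is_egd ?G" "snd F1 k \<le> snd F k" "snd ?G k \<le> snd F k" for k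
        using F1 G sndF by (auto simp: below_def snd_geo_restr simp del: geo_restr.simps)
      \<comment> \<open>The exit branch takes at most the share \<open>1 - c\<close> of
        \<open>t * F\<close> and the continuation at most the share \<open>c\<close>, so the join
        fits below \<open>t * F\<close>.\<close>
      show "egd_mass F1 x + egd_mass ?G x \<le> t * egd_mass F x" for x
      proof -
        have "egd_mass ?G x \<le> t * (weight (ENot E) x * egd_mass R x)"
          using G unfolding below_def by (simp only: egd_mass_geo_restr)
        also have "\<dots> = t * ((1 - c) * egd_mass F x)"
          by (simp only: massF)
        finally have "egd_mass ?G x \<le> t * ((1 - c) * egd_mass F x)" .
        moreover have "egd_mass F1 x \<le> c * t * egd_mass F x"
          using F1 by (simp add: below_def)
        ultimately show ?thesis
          by (simp add: algebra_simps)
      qed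
    qed blast
    have "emass F' y \<le> ?W (emass D') y + ennreal (t * (c ^ (u - v) + X)) * emass F y" for y
    proof -
      let ?f = "emass F y"
      let ?w = "?W (denot B (reweight E (emass D'))) y"
      \<comment> \<open>The body error is relative to \<open>S\<close>, and the loop maps
        \<open>S\<close> below \<open>c * F\<close>; so it counts only as
        \<open>e * c\<close>.\<close>
      have "?W (emass S') y \<le> ?W (\<lambda>x. denot B (reweight E (emass D')) x + ennreal (t * e) * emass S x) y"
        using S'(3) by (intro denot_mono) (simp only: emass_geo_restr[OF E])
      also have "\<dots> = ?w + ennreal (t * e) * ?W (emass S) y"
        by (simp only: denot_add denot_cmult)
      also have "\<dots> \<le> ?w + ennreal (t * e) * (ennreal c * ?f)"
        by (intro add_left_mono mult_left_mono WS) simp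
      finally have "emass F1 y \<le> ?w + ennreal (t * e) * (ennreal c * ?f)
          + ennreal (c * t * (c ^ d + X)) * ?f"
        by (intro order_trans[OF F1(4)] add_right_mono)
      then have "emass F' y \<le> ?w + ennreal (t * e) * (ennreal c * ?f)
          + ennreal (c * t * (c ^ d + X)) * ?f + reweight (ENot E) (emass D') y + ennreal (t * \<epsilon>) * ?f"
        unfolding emass_geo_restr[OF E', symmetric]
        by (intro order_trans[OF F'(4)] add_right_mono)
      also have "\<dots> = ?W (emass D') y
          + (ennreal (t * e) * (ennreal c * ?f) + ennreal (c * t * (c ^ d + X)) * ?f + ennreal (t * \<epsilon>) * ?f)"
        by (subst denot_While_unfold) (simp only: add_ac)
      also have "ennreal (t * e) * (ennreal c * ?f) + ennreal (c * t * (c ^ d + X)) * ?f + ennreal (t * \<epsilon>) * ?f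
          = ennreal (t * e * c + c * t * (c ^ d + X) + t * \<epsilon>) * ?f"
        using Suc(3) c e X by (simp add: distrib_left distrib_right ennreal_mult mult_ac)
      also have "\<dots> \<le> ennreal (t * (c ^ (u - v) + X)) * ?f"
      proof (intro mult_right_mono ennreal_leI)
        have "e * c + \<epsilon> \<le> (1 - c) * X"
          using c e X mult_left_mono[of c 1 e] by simp
        then have "t * (e * c + \<epsilon>) \<le> t * ((1 - c) * X)"
          using Suc(3) by (rule mult_left_mono)
        then show "t * e * c + c * t * (c ^ d + X) + t * \<epsilon> \<le> t * (c ^ (u - v) + X)"
          unfolding d(3) by (simp add: algebra_simps)
      qed simp
      finally show ?thesis
        by (simp add: add_left_mono)
    qed
    moreover have "geo (unroll_loop E (unroll u B) u v) D' F'"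
    proof -
      have "is_egd S'" "is_egd F1" "is_egd ?G"
        using S' F1 G by (auto simp: below_def)
      then show ?thesis
        using d(2) S'(1) F1(1) F'(1)
        by (subst unroll_loop.simps)
          (auto simp: geo_IfElse geo_Seq geo_Skip simp del: geo_restr.simps split_paired_Ex)
    qed
    ultimately show ?case
      using F' by blast
  qed
  show ?thesis
    unfolding unroll_approx_def
  proof (intro allI impI)
    fix t :: real and D' :: "'n egd" assume t: "0 \<le> t" "below t D' D"
    have "below t D' R"
      unfolding below_def
    proof (intro conjI allI)
      show "snd D' k \<le> snd R k" for k
        using t DR unfolding below_def by (meson order_trans)
      show "egd_mass D' x \<le> t * egd_mass R x" for x
        using t DR mult_left_mono[of "egd_mass D x" "egd_mass R x" t]
        unfolding below_def by (metis mult_1 order_trans)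
    qed (use t in \<open>simp add: below_def\<close>)
    from loop[OF t(1) this, of 0, unfolded X_def]
    show "\<exists>F'. geo (unroll u (While E B)) D' F' \<and> below t F' F \<and> (snd D' = snd D \<longrightarrow> snd F' = snd F) \<and>
        (\<forall>y. emass F' y \<le> ?W (emass D') y + ennreal (t * (c ^ u + (e + \<epsilon>) / (1 - c))) * emass F y)"
      by auto
  qed
qed

lemma unroll_converges:
  fixes D F :: "'n::finite egd"
  assumes "wf_prog P" "is_egd D" "is_egd F" "geo P D F"
  shows "\<exists>A C. 0 \<le> A \<and> 0 \<le> C \<and> C < 1 \<and> (\<forall>u. unroll_approx u P D F (A * C ^ u))"
  using assms
proof (induction P arbitrary: D F)
  case (Seq P1 P2)
  then obtain R where R: "is_egd R" "geo P1 D R" "geo P2 R F"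
    by (auto simp: geo_Seq)
  have wf: "wf_prog P1" "wf_prog P2"
    using Seq by auto
  obtain A1 C1 where 1: "0 \<le> A1" "0 \<le> C1" "C1 < 1" "\<And>u. unroll_approx u P1 D R (A1 * C1 ^ u)"
    using Seq.IH(1)[OF wf(1) Seq.prems(2) R(1,2)] by blast
  obtain A2 C2 where 2: "0 \<le> A2" "0 \<le> C2" "C2 < 1" "\<And>u. unroll_approx u P2 R F (A2 * C2 ^ u)"
    using Seq.IH(2)[OF wf(2) R(1) Seq.prems(3) R(3)] by blast
  define C where "C = max C1 C2"
  have "unroll_approx u (Seq P1 P2) D F ((A1 + A2) * C ^ u)" for u
  proof (rule unroll_approx_mono)
    show "unroll_approx u (Seq P1 P2) D F (A1 * C1 ^ u + A2 * C2 ^ u)"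
      using 1 2 R wf Seq.prems by (intro unroll_approx_Seq[of _ _ _ R] geo_sound) auto
    have "A1 * C1 ^ u \<le> A1 * C ^ u" "A2 * C2 ^ u \<le> A2 * C ^ u"
      using 1 2 by (auto simp: C_def intro!: mult_left_mono power_mono)
    then show "A1 * C1 ^ u + A2 * C2 ^ u \<le> (A1 + A2) * C ^ u"
      by (simp add: distrib_right)
  qed
  then show ?case
    using 1 2 by (intro exI[of _ "A1 + A2"] exI[of _ C]) (auto simp: C_def)
next
  case (IfElse E P1 P2)
  then obtain R S where RS: "is_egd R" "is_egd S" "geo P1 (geo_restr E D) R"
    "geo P2 (geo_restr (ENot E) D) S" "(R, S, F) \<in> Join"
    by (auto simp: geo_IfElse)
  have wf: "wf_event E" "wf_event (ENot E)" "wf_prog P1" "wf_prog P2"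
    using IfElse by auto
  note restr = is_egd_geo_restr[OF IfElse.prems(2) wf(1)] is_egd_geo_restr[OF IfElse.prems(2) wf(2)]
  obtain A1 C1 where 1: "0 \<le> A1" "0 \<le> C1" "C1 < 1"
    "\<And>u. unroll_approx u P1 (geo_restr E D) R (A1 * C1 ^ u)"
    using IfElse.IH(1)[OF wf(3) restr(1) RS(1,3)] by blast
  obtain A2 C2 where 2: "0 \<le> A2" "0 \<le> C2" "C2 < 1"
    "\<And>u. unroll_approx u P2 (geo_restr (ENot E) D) S (A2 * C2 ^ u)"
    using IfElse.IH(2)[OF wf(4) restr(2) RS(2,4)] by blast
  \<comment> \<open>The join error can be chosen freely and is set to \<open>(1 / 2) ^ u\<close>,
    hence the \<open>1 / 2\<close> here.\<close>
  define C where "C = max (1 / 2) (max C1 C2)"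
  have "unroll_approx u (IfElse E P1 P2) D F ((A1 + A2 + 1) * C ^ u)" for u
  proof (rule unroll_approx_mono)
    show "unroll_approx u (IfElse E P1 P2) D F (A1 * C1 ^ u + A2 * C2 ^ u + (1 / 2) ^ u)"
      using 1 2 RS IfElse.prems wf by (intro unroll_approx_IfElse[of _ R S]) auto
    have "A1 * C1 ^ u \<le> A1 * C ^ u" "A2 * C2 ^ u \<le> A2 * C ^ u" "(1 / 2) ^ u \<le> C ^ u"
      using 1 2 unfolding C_def by (auto intro!: mult_left_mono power_mono)
    then show "A1 * C1 ^ u + A2 * C2 ^ u + (1 / 2) ^ u \<le> (A1 + A2 + 1) * C ^ u"
      by (simp add: distrib_right)
  qed
  then show ?case
    using 1 2 by (intro exI[of _ "A1 + A2 + 1"] exI[of _ C]) (auto simp: C_def)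
next
  case (While E B)
  then obtain c R S where RS: "0 \<le> c" "c < 1" "is_egd R" "is_egd S" "D \<preceq>\<^sub>E R"
    "geo B (geo_restr E R) S" "S \<preceq>\<^sub>E (tscale c (fst R), snd R)"
    and F: "geo_restr (ENot E) (tscale (1 / (1 - c)) (fst R), snd R) = F"
    by (auto simp: geo_While simp del: geo_restr.simps)
  have wf: "wf_event E" "wf_prog B"
    using While by auto
  note restr = is_egd_geo_restr[OF RS(3) wf(1)]
  obtain A C where B: "0 \<le> A" "0 \<le> C" "C < 1"
    "\<And>u. unroll_approx u B (geo_restr E R) S (A * C ^ u)"
    using While.IH[OF wf(2) restr RS(4,6)] by blast
  have DR: "below 1 D R" "below c S R"
    using RS While.prems egd_le_iff[of D R] egd_le_iff[OF RS(4) is_egd_tscale[of "fst R" "snd R" c]]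
    by (simp_all add: below_def egd_mass_tscale)
  \<comment> \<open>\<open>c\<close> accounts for the mass left after \<open>u\<close> iterations,
    \<open>C\<close> for the body, and \<open>1 / 2\<close> for the joins, whose error is again
    \<open>(1 / 2) ^ u\<close>.\<close>
  define C' where "C' = max (1 / 2) (max c C)"
  have "unroll_approx u (While E B) D F ((1 + (A + 1) / (1 - c)) * C' ^ u)" for u
  proof (rule unroll_approx_mono)
    show "unroll_approx u (While E B) D F (c ^ u + (A * C ^ u + (1 / 2) ^ u) / (1 - c))"
      using B RS wf DR While.prems restr F
      by (intro unroll_approx_While[of _ R S] geo_sound) auto
    have "A * C ^ u \<le> A * C' ^ u" "c ^ u \<le> C' ^ u" "(1 / 2) ^ u \<le> C' ^ u"
      using B RS unfolding C'_def by (auto intro!: mult_left_mono power_mono)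
    then have "c ^ u + (A * C ^ u + (1 / 2) ^ u) / (1 - c) \<le> C' ^ u + (A * C' ^ u + C' ^ u) / (1 - c)"
      using RS by (intro add_mono divide_right_mono) auto
    also have "\<dots> = (1 + (A + 1) / (1 - c)) * C' ^ u"
      by (simp add: distrib_right)
    finally show "c ^ u + (A * C ^ u + (1 / 2) ^ u) / (1 - c) \<le> (1 + (A + 1) / (1 - c)) * C' ^ u" .
  qed
  then show ?case
    using B RS by (intro exI[of _ "1 + (A + 1) / (1 - c)"] exI[of _ C']) (auto simp: C'_def)
qed (rule exI[of _ 0], rule exI[of _ 0], simp add: unroll_approx_primitive del: geo.simps)+

section \<open>Discrete measures\<close>

lemma sets_discrete [simp]: "sets (discrete_measure f) = UNIV"
  unfolding discrete_measure_def by (subst sets_measure_of) auto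

lemma space_UNIV_if_sets: "sets M = UNIV \<Longrightarrow> space M = UNIV"
  using sets_eq_imp_space_eq[of M "count_space UNIV"] by simp

lemma measurable_if_sets_UNIV: "sets M = UNIV \<Longrightarrow> f \<in> borel_measurable M"
  by (simp add: measurable_def space_UNIV_if_sets)

text \<open>Naming a measure with the same values settles countable additivity at once.\<close>

lemma discrete_measure_eqI:
  assumes "sets M = UNIV" "\<And>S. f S = emeasure M S"
  shows "discrete_measure f = M"
proof -
  have "f = emeasure M"
    using assms by auto
  then show ?thesis
    using measure_of_of_measure[of M] assms(1)
    by (simp add: discrete_measure_def space_UNIV_if_sets)
qed

text \<open>\<open>measure_of\<close> falls back to the zero measure when \<open>f\<close> is not
  countably additive, so a clause that defines a measure by its values owes this check.\<close>

lemma emeasure_discrete_measure: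
  assumes "f {} = 0"
    and "\<And>A::nat \<Rightarrow> 'a set. disjoint_family A \<Longrightarrow> (\<Sum>i. f (A i)) = f (\<Union>i. A i)"
  shows "emeasure (discrete_measure f) S = f S"
proof (rule emeasure_measure_of)
  show "discrete_measure f = measure_of UNIV UNIV f"
    by (simp add: discrete_measure_def)
qed (use assms in \<open>auto simp: positive_def countably_additive_def\<close>)

lemma suminf_emeasure_UNIV:
  "sets M = UNIV \<Longrightarrow> disjoint_family A \<Longrightarrow> (\<Sum>i::nat. emeasure M (A i)) = emeasure M (\<Union>i. A i)"
  by (rule suminf_emeasure) auto

lemma sets_plus_m [simp]: "sets (M \<oplus>\<^sub>m N) = UNIV"
  by (simp add: plus_m_def)

lemma emeasure_plus_m:
  assumes "sets M = UNIV" "sets N = UNIV"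
  shows "emeasure (M \<oplus>\<^sub>m N) S = emeasure M S + emeasure N S"
  unfolding plus_m_def
  by (rule emeasure_discrete_measure)
    (simp_all add: suminf_emeasure_UNIV assms flip: suminf_add)

lemma suminf_swap_ennreal:
  fixes f :: "nat \<Rightarrow> nat \<Rightarrow> ennreal"
  shows "(\<Sum>i. \<Sum>j. f i j) = (\<Sum>j. \<Sum>i. f i j)"
  using nn_integral_suminf[of "\<lambda>j i. f i j" "count_space UNIV"]
  by (simp add: nn_integral_count_space_nat)

definition series_m :: "(nat \<Rightarrow> 'a measure) \<Rightarrow> 'a measure" where
  "series_m G = discrete_measure (\<lambda>S. \<Sum>n. emeasure (G n) S)"

lemma sets_series_m [simp]: "sets (series_m G) = UNIV"
  by (simp add: series_m_def)

lemma emeasure_series_m: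
  assumes "\<And>n. sets (G n) = UNIV"
  shows "emeasure (series_m G) S = (\<Sum>n. emeasure (G n) S)"
  unfolding series_m_def
proof (rule emeasure_discrete_measure)
  fix A :: "nat \<Rightarrow> 'a set" assume "disjoint_family A"
  then show "(\<Sum>i. \<Sum>n. emeasure (G n) (A i)) = (\<Sum>n. emeasure (G n) (\<Union>i. A i))"
    by (subst suminf_swap_ennreal) (simp add: suminf_emeasure_UNIV assms)
qed simp

text \<open>
  The least fixed point of a loop is explicit for all measures, finite or not: unrolling the
  fixed point equation shows that every fixed point dominates the series.
\<close>

lemma Least_affine_fixpoint:
  fixes T :: "'a measure \<Rightarrow> 'a measure"
  assumes G: "\<And>\<mu>. sets (G \<mu>) = UNIV"
  shows "(LEAST \<psi>. \<psi> = (\<lambda>\<mu>. G \<mu> \<oplus>\<^sub>m \<psi> (T \<mu>))) = (\<lambda>\<mu>. series_m (\<lambda>n. G ((T ^^ n) \<mu>)))"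
proof (rule Least_equality)
  show "(\<lambda>\<mu>. series_m (\<lambda>n. G ((T ^^ n) \<mu>))) = (\<lambda>\<mu>. G \<mu> \<oplus>\<^sub>m series_m (\<lambda>n. G ((T ^^ n) (T \<mu>))))"
  proof (intro ext measure_eqI)
    fix \<mu> S
    let ?g = "\<lambda>n. emeasure (G ((T ^^ n) \<mu>)) S"
    have "(\<Sum>n. ?g n) = ?g 0 + (\<Sum>n. ?g (Suc n))"
      using suminf_offset[of ?g 1] by (simp del: funpow.simps)
    then show "emeasure (series_m (\<lambda>n. G ((T ^^ n) \<mu>))) S =
        emeasure (G \<mu> \<oplus>\<^sub>m series_m (\<lambda>n. G ((T ^^ n) (T \<mu>)))) S"
      by (simp only: emeasure_series_m emeasure_plus_m G sets_series_m funpow_Suc_right o_apply funpow_0)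
  qed simp
next
  fix \<psi> assume fixpoint: "\<psi> = (\<lambda>\<mu>. G \<mu> \<oplus>\<^sub>m \<psi> (T \<mu>))"
  have \<psi>: "\<psi> \<mu> = G \<mu> \<oplus>\<^sub>m \<psi> (T \<mu>)" for \<mu>
    using fixpoint by (rule fun_cong)
  \<comment> \<open>Every value of a fixed point is a sum and so carries the discrete sigma-algebra,
    which reduces the order on measures to the setwise one.\<close>
  have sets: "sets (\<psi> \<mu>) = UNIV" for \<mu>
    by (subst \<psi>) simp
  have "(\<Sum>n<N. emeasure (G ((T ^^ n) \<mu>)) S) \<le> emeasure (\<psi> \<mu>) S" for N \<mu> S
  proof (induction N arbitrary: \<mu>)
    case (Suc N)
    have "(\<Sum>n<Suc N. emeasure (G ((T ^^ n) \<mu>)) S)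
        = emeasure (G \<mu>) S + (\<Sum>n<N. emeasure (G ((T ^^ n) (T \<mu>))) S)"
      by (simp only: sum.lessThan_Suc_shift funpow_Suc_right o_apply funpow_0)
    also have "\<dots> \<le> emeasure (G \<mu>) S + emeasure (\<psi> (T \<mu>)) S"
      by (intro add_left_mono Suc)
    also have "\<dots> = emeasure (\<psi> \<mu>) S"
      by (subst (2) \<psi>) (simp add: emeasure_plus_m G sets)
    finally show ?case .
  qed simp
  then have "(\<Sum>n. emeasure (G ((T ^^ n) \<mu>)) S) \<le> emeasure (\<psi> \<mu>) S" for \<mu> S
    by (intro suminf_le_const) auto
  then show "(\<lambda>\<mu>. series_m (\<lambda>n. G ((T ^^ n) \<mu>))) \<le> \<psi>"
    by (intro le_funI) (simp add: le_measure sets emeasure_series_m G)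
qed

section \<open>Event restrictions as densities and updates as image measures\<close>

lemma sets_restr_fail [simp]: "sets (restr_fail \<mu>) = UNIV"
  by (simp add: restr_fail_def)

lemma emeasure_restr_fail:
  assumes "sets \<mu> = UNIV"
  shows "emeasure (restr_fail \<mu>) S = emeasure \<mu> (S \<inter> {None})"
  unfolding restr_fail_def
proof (rule emeasure_discrete_measure)
  fix A :: "nat \<Rightarrow> 'a option set" assume "disjoint_family A"
  then show "(\<Sum>i. emeasure \<mu> (A i \<inter> {None})) = emeasure \<mu> ((\<Union>i. A i) \<inter> {None})"
    by (subst suminf_emeasure_UNIV) (auto simp: assms disjoint_family_on_def intro!: arg_cong[of _ _ "emeasure \<mu>"])
qed simp

lemma density_eqI:
  assumes "sets \<mu> = UNIV" "\<And>S. F S = (\<integral>\<^sup>+z. f z * indicator S z \<partial>\<mu>)"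
  shows "discrete_measure F = density \<mu> f"
  using assms by (intro discrete_measure_eqI) (auto simp: emeasure_density measurable_if_sets_UNIV)

text \<open>Weight 0 at failure, because every event restriction, even that of a coin flip, discards
  the failed mass.\<close>

definition oweight :: "'n event \<Rightarrow> 'n state option \<Rightarrow> ennreal" where
  "oweight E z = (case z of None \<Rightarrow> 0 | Some x \<Rightarrow> ennreal (weight E x))"

lemma sets_restr_ENot [simp]: "sets (restr (ENot E) \<mu>) = UNIV"
  by simp

lemma restr_ok_density:
  assumes "sets \<mu> = UNIV"
  shows "restr_ok \<mu> = density \<mu> (indicator (range Some))"
  unfolding restr_ok_def using assms
  by (intro density_eqI) (simp_all add: Int_commute flip: indicator_inter_arith)

lemma finite_density_oweight:
  assumes "sets \<mu> = UNIV" "emeasure \<mu> UNIV < \<infinity>" "wf_event E"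
  shows "emeasure (density \<mu> (oweight E)) S \<le> emeasure \<mu> S"
proof -
  have "(\<integral>\<^sup>+z. oweight E z * indicator S z \<partial>\<mu>) \<le> (\<integral>\<^sup>+z. indicator S z \<partial>\<mu>)"
    using weight_bounds[OF assms(3)]
    by (intro nn_integral_mono) (auto simp: oweight_def split: option.splits split_indicator)
  then show ?thesis
    using assms by (simp add: emeasure_density measurable_if_sets_UNIV)
qed

text \<open>The delicate case is negation, where a difference of integrals becomes the integral of
  the difference; this needs a finite subtrahend. Weights at most 1 keep the intermediate measure of
  a conjunction finite.\<close>

lemma restr_density:
  fixes \<mu> :: "'n state option measure"
  assumes "sets \<mu> = UNIV" "emeasure \<mu> UNIV < \<infinity>" "wf_event E"
  shows "restr E \<mu> = density \<mu> (oweight E)"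
  using assms
proof (induction E arbitrary: \<mu>)
  case (VarEq k a)
  have "{Some x |x. Some x \<in> S \<and> x k = a} = {z. oweight (VarEq k a) z = 1} \<inter> S" for S
    by (auto simp: oweight_def split: option.splits if_splits)
  moreover have "oweight (VarEq k a) = indicator {z. oweight (VarEq k a) z = 1}"
    by (auto simp: oweight_def fun_eq_iff split: option.splits split_indicator)
  ultimately show ?case
    unfolding restr.simps using VarEq
    by (intro density_eqI) (metis (no_types, lifting) UNIV_I indicator_inter_arith nn_integral_cong nn_integral_indicator)+
next
  case (Flip \<rho>)
  have "oweight (Flip \<rho>) z = ennreal \<rho> * indicator (range Some) z" for z :: "'n state option"
    by (auto simp: oweight_def fun_eq_iff split: option.splits split_indicator)
  then have "density \<mu> (oweight (Flip \<rho>)) = scale_measure (ennreal \<rho>) (density \<mu> (indicator (range Some)))"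
    using Flip by (intro measure_eqI)
      (simp_all add: emeasure_density measurable_if_sets_UNIV nn_integral_cmult mult.assoc)
  then show ?case
    using Flip by (simp add: restr_ok_density)
next
  case (ENot E)
  have wf: "wf_event E"
    using ENot by simp
  have meas: "f \<in> borel_measurable \<mu>" for f :: "_ \<Rightarrow> ennreal"
    using ENot by (simp add: measurable_if_sets_UNIV)
  have one_minus: "1 - ennreal w = ennreal (1 - w)" if "0 \<le> w" for w
    using ennreal_minus[OF that, of 1] by simp
  have "emeasure (density \<mu> (indicator (range Some))) S - emeasure (density \<mu> (oweight E)) S
      = (\<integral>\<^sup>+z. oweight (ENot E) z * indicator S z \<partial>\<mu>)" for S
  proof -
    have "emeasure (density \<mu> (oweight E)) S \<le> emeasure \<mu> UNIV"
      using finite_density_oweight[of \<mu> E S] ENot wf emeasure_mono[of S UNIV \<mu>]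
      by (auto intro: order_trans)
    then have fin: "(\<integral>\<^sup>+z. oweight E z * indicator S z \<partial>\<mu>) \<noteq> \<infinity>"
      using ENot by (auto simp: emeasure_density meas top_unique)
    have "(\<integral>\<^sup>+z. indicator (range Some) z * indicator S z \<partial>\<mu>) - (\<integral>\<^sup>+z. oweight E z * indicator S z \<partial>\<mu>)
        = (\<integral>\<^sup>+z. indicator (range Some) z * indicator S z - oweight E z * indicator S z \<partial>\<mu>)"
      using fin weight_bounds[OF wf]
      by (intro nn_integral_diff[symmetric] meas)
        (auto simp: oweight_def split: option.splits split_indicator)
    also have "\<dots> = (\<integral>\<^sup>+z. oweight (ENot E) z * indicator S z \<partial>\<mu>)"
      using weight_bounds[OF wf]
      by (intro nn_integral_cong)
        (auto simp: oweight_def one_minus split: option.splits split_indicator)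
    finally show ?thesis
      using ENot by (simp add: emeasure_density meas)
  qed
  then show ?case
    using ENot wf by (auto simp: restr_ok_density intro!: density_eqI)
next
  case (EAnd E1 E2)
  let ?\<nu> = "density \<mu> (oweight E1)"
  have wf: "wf_event E1" "wf_event E2"
    using EAnd by auto
  have "emeasure ?\<nu> UNIV < \<infinity>"
    using finite_density_oweight[of \<mu> E1 UNIV] EAnd wf by (auto intro: le_less_trans)
  then have "restr (EAnd E1 E2) \<mu> = density ?\<nu> (oweight E2)"
    using EAnd wf by simp
  also have "\<dots> = density \<mu> (oweight (EAnd E1 E2))"
  proof -
    have "oweight E1 z * oweight E2 z = oweight (EAnd E1 E2) z" for z
      using weight_bounds[OF wf(1)] weight_bounds[OF wf(2)]
      by (auto simp: oweight_def ennreal_mult split: option.splits)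
    then show ?thesis
      using EAnd by (subst density_density_eq) (auto simp: measurable_if_sets_UNIV)
  qed
  finally show ?case .
qed

lemma restr_finite:
  fixes \<mu> :: "'n state option measure"
  assumes "sets \<mu> = UNIV" "emeasure \<mu> UNIV < \<infinity>" "wf_event E"
  shows "sets (restr E \<mu>) = UNIV" "emeasure (restr E \<mu>) S \<le> emeasure \<mu> S"
    "emeasure (restr E \<mu>) UNIV < \<infinity>"
    "emeasure (restr E \<mu>) {Some x} = reweight E (\<lambda>x. emeasure \<mu> {Some x}) x"
proof -
  note * = restr_density[OF assms]
  show "sets (restr E \<mu>) = UNIV"
    using assms by (simp add: *)
  show le: "emeasure (restr E \<mu>) S \<le> emeasure \<mu> S" for S
    unfolding * by (rule finite_density_oweight[OF assms])
  show "emeasure (restr E \<mu>) UNIV < \<infinity>"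
    using le[of UNIV] assms(2) by (rule le_less_trans)
  show "emeasure (restr E \<mu>) {Some x} = reweight E (\<lambda>x. emeasure \<mu> {Some x}) x"
    using assms by (simp add: * emeasure_density measurable_if_sets_UNIV reweight_def oweight_def)
qed

text \<open>The three weights add up to 1 at every state. The identity controls the total mass in
  branches and loops.\<close>

lemma restr_partition:
  fixes \<mu> :: "'n state option measure"
  assumes "sets \<mu> = UNIV" "emeasure \<mu> UNIV < \<infinity>" "wf_event E"
  shows "emeasure (restr_fail \<mu>) UNIV + emeasure (restr (ENot E) \<mu>) UNIV + emeasure (restr E \<mu>) UNIV
    = emeasure \<mu> UNIV"
proof -
  have E': "wf_event (ENot E)"
    using assms by simp
  have meas: "f \<in> borel_measurable \<mu>" for f :: "_ \<Rightarrow> ennreal"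
    using assms by (simp add: measurable_if_sets_UNIV)
  have "emeasure (restr_fail \<mu>) UNIV + emeasure (restr (ENot E) \<mu>) UNIV + emeasure (restr E \<mu>) UNIV
      = (\<integral>\<^sup>+z. indicator {None} z \<partial>\<mu>) + (\<integral>\<^sup>+z. oweight (ENot E) z \<partial>\<mu>) + (\<integral>\<^sup>+z. oweight E z \<partial>\<mu>)"
    unfolding restr_density[OF assms(1,2) E'] restr_density[OF assms]
    using assms by (simp add: emeasure_restr_fail emeasure_density meas)
  also have "\<dots> = (\<integral>\<^sup>+z. indicator {None} z + oweight (ENot E) z + oweight E z \<partial>\<mu>)"
    by (simp add: nn_integral_add meas)
  also have "\<dots> = (\<integral>\<^sup>+z. 1 \<partial>\<mu>)"
    using weight_bounds[OF assms(3)]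
    by (intro nn_integral_cong)
      (auto simp: oweight_def split: option.splits split_indicator simp flip: ennreal_plus)
  finally show ?thesis
    using assms by (simp add: space_UNIV_if_sets)
qed

text \<open>\<open>map_option f\<close> fixes failure, so the two summands are the two parts of one
  preimage.\<close>

lemma update_distr:
  assumes "sets \<mu> = UNIV"
  shows "update f \<mu> = distr \<mu> (count_space UNIV) (map_option f)"
  unfolding update_def
proof (rule discrete_measure_eqI)
  fix S
  have "emeasure (distr \<mu> (count_space UNIV) (map_option f)) S = emeasure \<mu> (map_option f -` S)"
    using assms by (subst emeasure_distr) (auto simp: measurable_def space_UNIV_if_sets)
  also have "map_option f -` S = (S \<inter> {None}) \<union> {Some x |x. Some (f x) \<in> S}"
    by (auto simp: map_option_case split: option.splits)
  also have "emeasure \<mu> \<dots> = emeasure \<mu> (S \<inter> {None}) + emeasure \<mu> {Some x |x. Some (f x) \<in> S}"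
    using assms by (intro plus_emeasure[symmetric]) auto
  finally show "emeasure (restr_fail \<mu>) S + emeasure \<mu> {Some x |x. Some (f x) \<in> S} =
      emeasure (distr \<mu> (count_space UNIV) (map_option f)) S"
    using assms by (simp add: emeasure_restr_fail)
qed simp

lemma update_finite:
  fixes \<mu> :: "'n::finite state option measure"
  assumes "sets \<mu> = UNIV"
  shows "sets (update f \<mu>) = UNIV" "emeasure (update f \<mu>) UNIV = emeasure \<mu> UNIV"
    "emeasure (update f \<mu>) {Some y} = push f (\<lambda>x. emeasure \<mu> {Some x}) y"
proof -
  have meas: "map_option f \<in> measurable \<mu> (count_space UNIV)"
    using assms by (auto simp: measurable_def space_UNIV_if_sets)
  show "sets (update f \<mu>) = UNIV" "emeasure (update f \<mu>) UNIV = emeasure \<mu> UNIV"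
    using assms meas by (simp_all add: update_distr emeasure_distr space_UNIV_if_sets)
  have "emeasure (update f \<mu>) {Some y} = emeasure \<mu> (map_option f -` {Some y})"
    using assms meas by (simp add: update_distr emeasure_distr space_UNIV_if_sets)
  also have "map_option f -` {Some y} = Some ` (f -` {y})"
    by (auto simp: map_option_case split: option.splits)
  also have "emeasure \<mu> \<dots> = (\<integral>\<^sup>+z. emeasure \<mu> {z} \<partial>count_space (Some ` (f -` {y})))"
    using assms by (intro emeasure_countable_singleton) auto
  also have "\<dots> = push f (\<lambda>x. emeasure \<mu> {Some x}) y"
    unfolding push_def
    by (rule nn_integral_bij_count_space[symmetric]) (simp add: bij_betw_def inj_on_def)
  finally show "emeasure (update f \<mu>) {Some y} = push f (\<lambda>x. emeasure \<mu> {Some x}) y" .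
qed

lemma sem_full_While:
  "sem_full (While E B) \<mu> = series_m (\<lambda>n. let \<nu> = ((\<lambda>\<mu>. sem_full B (restr E \<mu>)) ^^ n) \<mu>
     in restr_fail \<nu> \<oplus>\<^sub>m restr (ENot E) \<nu>)"
  unfolding sem_full.simps Let_def by (subst Least_affine_fixpoint) simp_all

text \<open>
  Finiteness of the measure is part of the induction, since \<open>restr (ENot E)\<close> is a genuine
  restriction only of finite measures.
\<close>

lemma sem_full_denot:
  fixes \<mu> :: "'n::finite state option measure"
  assumes "wf_prog P" "sets \<mu> = UNIV" "emeasure \<mu> UNIV < \<infinity>"
  shows "sets (sem_full P \<mu>) = UNIV \<and> emeasure (sem_full P \<mu>) UNIV \<le> emeasure \<mu> UNIV \<and>
    (\<forall>y. emeasure (sem_full P \<mu>) {Some y} = denot P (\<lambda>x. emeasure \<mu> {Some x}) y)"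
  using assms
proof (induction P arbitrary: \<mu>)
  case (Seq P1 P2)
  have 1: "sets (sem_full P1 \<mu>) = UNIV" "emeasure (sem_full P1 \<mu>) UNIV \<le> emeasure \<mu> UNIV"
    "\<And>y. emeasure (sem_full P1 \<mu>) {Some y} = denot P1 (\<lambda>x. emeasure \<mu> {Some x}) y"
    using Seq.IH(1)[of \<mu>] Seq.prems by auto
  have "emeasure (sem_full P1 \<mu>) UNIV < \<infinity>"
    using 1(2) Seq.prems(3) by (rule le_less_trans)
  then have 2: "sets (sem_full P2 (sem_full P1 \<mu>)) = UNIV"
    "emeasure (sem_full P2 (sem_full P1 \<mu>)) UNIV \<le> emeasure (sem_full P1 \<mu>) UNIV"
    "\<And>y. emeasure (sem_full P2 (sem_full P1 \<mu>)) {Some y} =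
       denot P2 (\<lambda>x. emeasure (sem_full P1 \<mu>) {Some x}) y"
    using Seq.IH(2)[of "sem_full P1 \<mu>"] Seq.prems 1(1) by auto
  show ?case
    using 2 order_trans[OF 2(2) 1(2)] by (simp add: 1(3))
next
  case (IfElse E P1 P2)
  have wf: "wf_event E" "wf_event (ENot E)" "wf_prog P1" "wf_prog P2"
    using IfElse by auto
  let ?E = "restr E \<mu>" and ?N = "restr (ENot E) \<mu>"
  note E = restr_finite[OF IfElse.prems(2,3) wf(1)]
  note N = restr_finite[OF IfElse.prems(2,3) wf(2)]
  have 1: "sets (sem_full P1 ?E) = UNIV" "emeasure (sem_full P1 ?E) UNIV \<le> emeasure ?E UNIV"
    "\<And>y. emeasure (sem_full P1 ?E) {Some y} = denot P1 (\<lambda>x. emeasure ?E {Some x}) y"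
    using IfElse.IH(1)[OF wf(3) E(1,3)] by auto
  have 2: "sets (sem_full P2 ?N) = UNIV" "emeasure (sem_full P2 ?N) UNIV \<le> emeasure ?N UNIV"
    "\<And>y. emeasure (sem_full P2 ?N) {Some y} = denot P2 (\<lambda>x. emeasure ?N {Some x}) y"
    using IfElse.IH(2)[OF wf(4) N(1,3)] by auto
  have em: "emeasure (sem_full (IfElse E P1 P2) \<mu>) S =
      emeasure (restr_fail \<mu>) S + emeasure (sem_full P1 ?E) S + emeasure (sem_full P2 ?N) S" for S
    unfolding sem_full.simps by (simp only: emeasure_plus_m sets_plus_m sets_restr_fail 1(1) 2(1))
  have "emeasure (sem_full (IfElse E P1 P2) \<mu>) UNIV
      \<le> emeasure (restr_fail \<mu>) UNIV + emeasure ?E UNIV + emeasure ?N UNIV"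
    unfolding em by (intro add_mono order_refl 1(2) 2(2))
  also have "\<dots> = emeasure \<mu> UNIV"
    using restr_partition[OF IfElse.prems(2,3) wf(1)] by (simp only: add_ac)
  finally have "emeasure (sem_full (IfElse E P1 P2) \<mu>) UNIV \<le> emeasure \<mu> UNIV" .
  moreover have "emeasure (sem_full (IfElse E P1 P2) \<mu>) {Some y} =
      denot (IfElse E P1 P2) (\<lambda>x. emeasure \<mu> {Some x}) y" for y
    unfolding em 1(3) 2(3) E(4) N(4) using IfElse.prems by (simp add: emeasure_restr_fail)
  ultimately show ?case
    by simp
next
  case (While E B)
  have wf: "wf_event E" "wf_event (ENot E)" "wf_prog B"
    using While by auto
  let ?T = "\<lambda>\<mu>. sem_full B (restr E \<mu>)"
  let ?\<nu> = "\<lambda>n. (?T ^^ n) \<mu>"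
  let ?G = "\<lambda>n. restr_fail (?\<nu> n) \<oplus>\<^sub>m restr (ENot E) (?\<nu> n)"
  let ?f = "\<lambda>n. ((\<lambda>g. denot B (reweight E g)) ^^ n) (\<lambda>x. emeasure \<mu> {Some x})"
  have sem: "sem_full (While E B) \<mu> = series_m ?G"
    by (simp only: sem_full_While Let_def)
  \<comment> \<open>Mass that has failed or left in earlier rounds plus mass still running never
    exceeds the initial mass; this bounds the partial sums of the series.\<close>
  have inv: "sets (?\<nu> n) = UNIV \<and> emeasure (?\<nu> n) UNIV < \<infinity> \<and> (\<forall>y. emeasure (?\<nu> n) {Some y} = ?f n y) \<and>
      (\<Sum>i<n. emeasure (?G i) UNIV) + emeasure (?\<nu> n) UNIV \<le> emeasure \<mu> UNIV" for n
  proof (induction n)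
    case (Suc n)
    then have n: "sets (?\<nu> n) = UNIV" "emeasure (?\<nu> n) UNIV < \<infinity>"
      "\<And>y. emeasure (?\<nu> n) {Some y} = ?f n y"
      "(\<Sum>i<n. emeasure (?G i) UNIV) + emeasure (?\<nu> n) UNIV \<le> emeasure \<mu> UNIV"
      by auto
    note E = restr_finite[OF n(1,2) wf(1)]
    have B: "sets (?\<nu> (Suc n)) = UNIV" "emeasure (?\<nu> (Suc n)) UNIV \<le> emeasure (restr E (?\<nu> n)) UNIV"
      "\<And>y. emeasure (?\<nu> (Suc n)) {Some y} = denot B (\<lambda>x. emeasure (restr E (?\<nu> n)) {Some x}) y"
      using While.IH[OF wf(3) E(1,3)] by auto
    have "emeasure (?G n) UNIV + emeasure (?\<nu> (Suc n)) UNIV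
        \<le> emeasure (restr_fail (?\<nu> n)) UNIV + emeasure (restr (ENot E) (?\<nu> n)) UNIV
          + emeasure (restr E (?\<nu> n)) UNIV"
      by (simp only: emeasure_plus_m sets_restr_fail sets_restr_ENot) (intro add_left_mono B(2))
    also have "\<dots> = emeasure (?\<nu> n) UNIV"
      by (rule restr_partition[OF n(1,2) wf(1)])
    finally have "(\<Sum>i<Suc n. emeasure (?G i) UNIV) + emeasure (?\<nu> (Suc n)) UNIV
        \<le> (\<Sum>i<n. emeasure (?G i) UNIV) + emeasure (?\<nu> n) UNIV"
      unfolding sum.lessThan_Suc add.assoc by (rule add_left_mono)
    also note n(4)
    finally have "(\<Sum>i<Suc n. emeasure (?G i) UNIV) + emeasure (?\<nu> (Suc n)) UNIV \<le> emeasure \<mu> UNIV" .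
    moreover have "emeasure (?\<nu> (Suc n)) UNIV < \<infinity>"
      using B(2) E(3) by (rule le_less_trans)
    moreover have "emeasure (?\<nu> (Suc n)) {Some y} = ?f (Suc n) y" for y
      unfolding B(3) E(4) n(3) by simp
    ultimately show ?case
      using B(1) by blast
  qed (use While.prems in simp)
  have em: "emeasure (series_m ?G) S = (\<Sum>n. emeasure (?G n) S)" for S
    by (rule emeasure_series_m) simp
  have "(\<Sum>i<n. emeasure (?G i) UNIV) \<le> emeasure \<mu> UNIV" for n
    using inv[of n] by (auto intro: order_trans[rotated])
  then have "(\<Sum>n. emeasure (?G n) UNIV) \<le> emeasure \<mu> UNIV"
    by (intro suminf_le_const) auto
  moreover have "emeasure (?G n) {Some y} = reweight (ENot E) (?f n) y" for n y
  proof -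
    have "emeasure (?G n) {Some y} = emeasure (restr_fail (?\<nu> n)) {Some y} + emeasure (restr (ENot E) (?\<nu> n)) {Some y}"
      by (rule emeasure_plus_m) simp_all
    also have "emeasure (restr_fail (?\<nu> n)) {Some y} = 0"
      using inv[of n] by (simp add: emeasure_restr_fail)
    also have "emeasure (restr (ENot E) (?\<nu> n)) {Some y} = reweight (ENot E) (?f n) y"
      using restr_finite(4)[of "?\<nu> n" "ENot E" y] inv[of n] wf(2) by simp
    finally show ?thesis
      by simp
  qed
  ultimately show ?case
    unfolding sem em by simp
next
  case Fail
  have "emeasure (sem_full Fail \<mu>) S = emeasure \<mu> UNIV * indicator S None" for S
    unfolding sem_full.simps by (rule emeasure_discrete_measure) (simp_all add: suminf_indicator)
  then show ?case
    by simp
qed (simp_all add: update_finite)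

section \<open>Moments and total variation\<close>

text \<open>Termwise differentiation of the power series with coefficients \<open>n ^ p\<close>
  raises the exponent by one and keeps convergence inside radius 1.\<close>

lemma summable_power_times_geometric:
  fixes r :: real
  assumes "\<bar>r\<bar> < 1"
  shows "summable (\<lambda>n. real n ^ p * r ^ n)"
  using assms
proof (induction p arbitrary: r)
  case 0
  then show ?case
    by (simp add: summable_geometric)
next
  case (Suc p)
  have "summable (\<lambda>n. diffs (\<lambda>n. real n ^ p) n * r ^ n)"
    by (rule termdiff_converges[of r 1]) (use Suc in auto)
  then have "summable (\<lambda>n. r * (diffs (\<lambda>n. real n ^ p) n * r ^ n))"
    by (rule summable_mult)
  then have "summable (\<lambda>n. real (Suc n) ^ Suc p * r ^ Suc n)"
    by (simp add: diffs_def mult_ac)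
  then show ?case
    by (subst (asm) summable_Suc_iff)
qed

lemma summable_power_times_tail:
  fixes a :: real
  assumes "0 \<le> a" "a < 1"
  shows "summable (\<lambda>n. real n ^ p * a ^ (n + 1 - s))"
proof (rule summable_comparison_test')
  \<comment> \<open>Strictly between \<open>a\<close> and 1, hence positive even for
    \<open>a = 0\<close>, so that division by \<open>r ^ s\<close> can compensate for the truncated
    exponent.\<close>
  define r where "r = (1 + a) / 2"
  have r: "0 < r" "r < 1" "a \<le> r"
    using assms by (auto simp: r_def)
  show "summable (\<lambda>n. (real n ^ p * r ^ n) / r ^ s)"
    using r by (intro summable_divide summable_power_times_geometric) auto
  fix n :: nat
  have "a ^ (n + 1 - s) * r ^ s \<le> r ^ (n + 1 - s) * r ^ s"
    using r assms by (intro mult_right_mono power_mono) auto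
  also have "\<dots> = r ^ (n + 1 - s + s)"
    by (simp add: power_add)
  also have "\<dots> \<le> r ^ n"
    using r by (intro power_decreasing) auto
  finally have "a ^ (n + 1 - s) \<le> r ^ n / r ^ s"
    using r by (simp add: pos_le_divide_eq)
  then show "norm (real n ^ p * a ^ (n + 1 - s)) \<le> (real n ^ p * r ^ n) / r ^ s"
    using assms mult_left_mono[of "a ^ (n + 1 - s)" "r ^ n / r ^ s" "real n ^ p"] by simp
qed

text \<open>The mass is at most the sum of all entries times a product of one function per
  coordinate, and such a product is summable if each factor is; the moment affects only factor
  \<open>i\<close>.\<close>

lemma integrable_egd_moment:
  fixes D :: "'n::finite egd"
  assumes "is_egd D"
  shows "integrable (count_space UNIV) (\<lambda>x. egd_mass D x * real (x i) ^ p)"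
proof -
  obtain P \<alpha> where D: "D = (P, \<alpha>)"
    by (cases D)
  have a: "0 \<le> \<alpha> k" "\<alpha> k < 1" and entry: "0 \<le> entry P x" for k x
    using assms by (auto simp: D is_egd_def)
  define f where "f = (\<lambda>k m. (if k = i then real m ^ p else 1) * \<alpha> k ^ (m + 1 - tsize P k))"
  have f: "Infinite_Set_Sum.abs_summable_on (f k) UNIV" for k
    using summable_power_times_tail[of "\<alpha> k" "if k = i then p else 0" "tsize P k"] a
    by (auto simp: f_def abs_summable_on_nat_iff' split: if_splits)
  have "Infinite_Set_Sum.abs_summable_on (\<lambda>x. \<Prod>k\<in>UNIV. f k (x k)) (PiE UNIV (\<lambda>_. UNIV))"
    using f by (intro abs_summable_on_prod_PiE) auto
  then have int: "integrable (count_space UNIV) (\<lambda>x::'n state. \<Prod>k\<in>UNIV. f k (x k))"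
    by (simp add: abs_summable_on_def)
  have f_prod: "(\<Prod>k\<in>UNIV. f k (x k)) = real (x i) ^ p * (\<Prod>k\<in>UNIV. \<alpha> k ^ (x k + 1 - tsize P k))" for x
    by (simp add: f_def prod.distrib)
  define I where "I = PiE UNIV (\<lambda>k. {..<tsize P k})"
  have "finite I"
    by (auto simp: I_def intro!: finite_PiE)
  have "egd_mass D x * real (x i) ^ p \<le> (\<Sum>j\<in>I. entry P j) * (\<Prod>k\<in>UNIV. f k (x k))" for x
  proof -
    let ?j = "\<lambda>k. min (x k) (tsize P k - 1)"
    have "?j k < tsize P k" for k
      using tsize_pos[of P k] by linarith
    then have "?j \<in> I"
      by (auto simp: I_def)
    then have "entry P ?j \<le> (\<Sum>j\<in>I. entry P j)"
      using \<open>finite I\<close> entry by (intro member_le_sum) auto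
    then have "entry P ?j * (\<Prod>k\<in>UNIV. f k (x k)) \<le> (\<Sum>j\<in>I. entry P j) * (\<Prod>k\<in>UNIV. f k (x k))"
      using a by (intro mult_right_mono) (auto simp: f_prod intro!: mult_nonneg_nonneg prod_nonneg)
    then show ?thesis
      by (simp add: D egd_mass_def f_prod mult_ac)
  qed
  moreover have "0 \<le> egd_mass D x * real (x i) ^ p" for x
    using egd_mass_nonneg[OF assms] by simp
  ultimately show ?thesis
    by (intro Bochner_Integration.integrable_bound[OF integrable_mult_right[OF int, of "\<Sum>j\<in>I. entry P j"]])
      (auto intro!: AE_I2 abs_ge_self[THEN order_trans[rotated]])
qed

lemma summable_on_egd_moment:
  assumes "is_egd D"
  shows "(\<lambda>x. egd_mass D x * real (x i) ^ p) summable_on UNIV"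
proof -
  have "Infinite_Set_Sum.abs_summable_on (\<lambda>x. egd_mass D x * real (x i) ^ p) UNIV"
    unfolding abs_summable_on_def by (rule integrable_egd_moment[OF assms])
  then show ?thesis
    unfolding abs_summable_equivalent[symmetric] using egd_mass_nonneg[OF assms] by simp
qed

section \<open>From mass functions back to measures\<close>

lemma sets_EGD [simp]: "sets (EGD D) = UNIV"
  by (simp add: EGD_def)

lemma emeasure_EGD_singleton: "emeasure (EGD D) {x} = emass D x"
  by (simp add: EGD_def emeasure_density)

lemma finite_EGD:
  assumes "is_egd D"
  shows "emeasure (EGD D) UNIV < \<infinity>"
proof -
  have "integrable (count_space UNIV) (egd_mass D)"
    using integrable_egd_moment[OF assms, of _ 0] by simp
  then have "(\<integral>\<^sup>+x. emass D x \<partial>count_space UNIV) = ennreal (\<integral>x. egd_mass D x \<partial>count_space UNIV)"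
    using egd_mass_nonneg[OF assms] by (intro nn_integral_eq_integral) auto
  then show ?thesis
    by (simp add: EGD_def emeasure_density)
qed

lemma sets_sem [simp]: "sets (sem P \<mu>) = UNIV"
  by (simp add: sem_def)

lemma sem_denot:
  fixes \<mu> :: "'n::finite state measure"
  assumes P: "wf_prog P" and \<mu>: "sets \<mu> = UNIV" "emeasure \<mu> UNIV < \<infinity>"
  shows "emeasure (sem P \<mu>) UNIV < \<infinity>"
    "emeasure (sem P \<mu>) {y} = denot P (\<lambda>x. emeasure \<mu> {x}) y"
proof -
  let ?\<mu> = "distr \<mu> (count_space UNIV) Some"
  let ?\<nu> = "sem_full P ?\<mu>"
  have meas: "Some \<in> measurable \<mu> (count_space UNIV)"
    using \<mu> by (auto simp: measurable_def space_UNIV_if_sets)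
  have total: "emeasure ?\<mu> UNIV = emeasure \<mu> UNIV"
    and single: "\<And>x. emeasure ?\<mu> {Some x} = emeasure \<mu> {x}"
    using meas \<mu> by (simp_all add: emeasure_distr space_UNIV_if_sets vimage_def)
  have \<nu>: "sets ?\<nu> = UNIV" "emeasure ?\<nu> UNIV \<le> emeasure \<mu> UNIV"
    "\<And>y. emeasure ?\<nu> {Some y} = denot P (\<lambda>x. emeasure \<mu> {x}) y"
    using sem_full_denot[OF P, of ?\<mu>] \<mu> by (auto simp: total single)
  have em: "emeasure (sem P \<mu>) S = emeasure ?\<nu> (Some ` S)" for S
    unfolding sem_def
  proof (rule emeasure_discrete_measure)
    fix A :: "nat \<Rightarrow> 'n state set" assume "disjoint_family A"
    then show "(\<Sum>i. emeasure ?\<nu> (Some ` A i)) = emeasure ?\<nu> (Some ` (\<Union>i. A i))"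
      unfolding image_UN
      by (intro suminf_emeasure_UNIV \<nu>) (auto simp: disjoint_family_on_def)
  qed simp
  show "emeasure (sem P \<mu>) {y} = denot P (\<lambda>x. emeasure \<mu> {x}) y"
    by (simp add: em \<nu>)
  have "emeasure (sem P \<mu>) UNIV \<le> emeasure ?\<nu> UNIV"
    unfolding em using \<nu> by (intro emeasure_mono) auto
  also have "\<dots> \<le> emeasure \<mu> UNIV"
    by (rule \<nu>)
  finally show "emeasure (sem P \<mu>) UNIV < \<infinity>"
    using \<mu>(2) by (rule le_less_trans)
qed

lemma emeasure_mono_singletons:
  fixes M N :: "'a::countable measure"
  assumes "sets M = UNIV" "sets N = UNIV" "\<And>x. emeasure M {x} \<le> emeasure N {x}"
  shows "emeasure M S \<le> emeasure N S"
proof -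
  have "emeasure K S = (\<integral>\<^sup>+x. emeasure K {x} \<partial>count_space S)" if "sets K = UNIV" for K :: "'a measure"
    using that by (intro emeasure_countable_singleton) auto
  then show ?thesis
    using assms by (auto intro: nn_integral_mono)
qed

lemma wf_unroll: "wf_prog P \<Longrightarrow> wf_prog (unroll u P)"
proof (induction P)
  case (While E B)
  have "wf_prog (unroll_loop E (unroll u B) u v)" for v
    using While by (induction "u - v" arbitrary: v) (subst unroll_loop.simps; auto)+
  then show ?case
    by simp
qed auto

theorem theorem4p17:
  fixes Prog :: "'n::finite prog" and P Q :: "'n tensor" and \<alpha> \<beta> :: "'n \<Rightarrow> real"
  assumes "wf_prog Prog"
    and "is_egd (P, \<alpha>)" and "is_egd (Q, \<beta>)"
    and "geo Prog (P, \<alpha>) (Q, \<beta>)"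
  shows "\<exists>(A::real) (C::real) (Qu :: nat \<Rightarrow> 'n tensor).
    0 \<le> A \<and> 0 \<le> C \<and> C < 1 \<and>
    (\<forall>u. is_egd (Qu u, \<beta>) \<and>
         geo (unroll u Prog) (P, \<alpha>) (Qu u, \<beta>) \<and>
         (Qu u, \<beta>) \<preceq>\<^sub>E (Q, \<beta>) \<and>
         (\<forall>S. measure (EGD (Qu u, \<beta>)) S - measure (sem Prog (EGD (P, \<alpha>))) S
              \<le> A * C ^ u * measure (EGD (Q, \<beta>)) S)) \<and>
    (\<lambda>u. tv_dist (EGD (Qu u, \<beta>)) (sem Prog (EGD (P, \<alpha>)))) \<longlonglongrightarrow> 0 \<and>
    (\<forall>(k::nat) (i::'n).
       (\<lambda>u. expect (EGD (Qu u, \<beta>)) (\<lambda>x. real (x i) ^ k))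
         \<longlonglongrightarrow> expect (sem Prog (EGD (P, \<alpha>))) (\<lambda>x. real (x i) ^ k))"
proof -
  let ?D = "(P, \<alpha>)" and ?F = "(Q, \<beta>)"
  let ?M = "sem Prog (EGD ?D)"
  obtain A C where AC: "0 \<le> A" "0 \<le> C" "C < 1"
    and approx: "\<And>u. unroll_approx u Prog ?D ?F (A * C ^ u)"
    using unroll_converges[OF assms] by blast
  have "\<exists>R. is_egd (R, \<beta>) \<and> geo (unroll u Prog) ?D (R, \<beta>) \<and> (R, \<beta>) \<preceq>\<^sub>E ?F \<and>
      (\<forall>y. emass (R, \<beta>) y \<le> denot Prog (emass ?D) y + ennreal (A * C ^ u) * emass ?F y)" for u
  proof -
    \<comment> \<open>The uniform claim is used at scale 1 and at the given initial bound itself,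
      where equal initial rates yield exactly \<beta>.\<close>
    have "below 1 ?D ?D"
      using assms by (simp add: below_def)
    then obtain F' where F': "geo (unroll u Prog) ?D F'" "below 1 F' ?F" "snd F' = \<beta>"
      "\<And>y. emass F' y \<le> denot Prog (emass ?D) y + ennreal (1 * (A * C ^ u)) * emass ?F y"
      using unroll_approxE[OF approx, of 1 ?D] by (metis snd_conv zero_le_one)
    obtain R where R: "F' = (R, \<beta>)"
      using F'(3) by (cases F') auto
    have "is_egd F'"
      using F' by (simp add: below_def)
    then show ?thesis
      using F' egd_le_iff[OF _ assms(3), of F'] unfolding R by (auto simp: below_def)
  qed
  then obtain Qu where Qu: "\<And>u. is_egd (Qu u, \<beta>)" "\<And>u. geo (unroll u Prog) ?D (Qu u, \<beta>)"
    "\<And>u. (Qu u, \<beta>) \<preceq>\<^sub>E ?F"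
    "\<And>u y. emass (Qu u, \<beta>) y \<le> denot Prog (emass ?D) y + ennreal (A * C ^ u) * emass ?F y"
    by metis
  have wf: "wf_prog (unroll u Prog)" for u
    by (rule wf_unroll) (rule assms)
  have lower: "denot Prog (emass ?D) y \<le> emass (Qu u, \<beta>) y" for u y
    using geo_sound[OF wf assms(2) Qu(1,2)] by (simp add: denot_unroll)
  note M = sem_denot[OF assms(1) sets_EGD finite_EGD[OF assms(2)], unfolded emeasure_EGD_singleton]
  define p where "p y = measure ?M {y}" for y
  have fin: "finite_measure ?M" "finite_measure (EGD (Qu u, \<beta>))" "finite_measure (EGD ?F)" for u
    using M(1) finite_EGD[OF Qu(1), of u] finite_EGD[OF assms(3)]
    by (auto intro!: finite_measureI simp: space_UNIV_if_sets)
  note em = finite_measure.emeasure_eq_measure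
  have p: "denot Prog (emass ?D) y = ennreal (p y)" "0 \<le> p y" for y
    using em[OF fin(1), of "{y}"] M(2) by (simp_all add: p_def)
  have mass: "measure (EGD (Qu u, \<beta>)) {y} = egd_mass (Qu u, \<beta>) y" for u y
    using egd_mass_nonneg[OF Qu(1), of u y] by (simp add: measure_def emeasure_EGD_singleton)
  have massF: "measure (EGD ?F) {y} = egd_mass ?F y" for y
    using egd_mass_nonneg[OF assms(3), of y] by (simp add: measure_def emeasure_EGD_singleton)
  have low: "p y \<le> egd_mass (Qu u, \<beta>) y" for u y
    using lower[of y u] egd_mass_nonneg[OF Qu(1), of u y] by (simp add: p)
  have upp: "egd_mass (Qu u, \<beta>) y \<le> p y + A * C ^ u * egd_mass ?F y" for u y
    using Qu(4)[of u y] AC egd_mass_nonneg[OF assms(3), of y] p(2)[of y]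
    by (simp add: p flip: ennreal_mult ennreal_plus)
  have leF: "egd_mass (Qu u, \<beta>) y \<le> egd_mass ?F y" for u y
    using Qu(1,3) assms(3) by (simp add: egd_le_iff)
  have meas_low: "measure ?M S \<le> measure (EGD (Qu u, \<beta>)) S" for u S
  proof -
    have "emeasure ?M S \<le> emeasure (EGD (Qu u, \<beta>)) S"
      by (rule emeasure_mono_singletons)
        (simp_all only: sets_sem sets_EGD M(2) emeasure_EGD_singleton lower)
    then show ?thesis
      by (simp add: em fin)
  qed
  have meas_upp: "measure (EGD (Qu u, \<beta>)) S \<le> measure ?M S + A * C ^ u * measure (EGD ?F) S" for u S
  proof -
    \<comment> \<open>The estimate is known only at points; \<open>?K\<close> is a measure whose
      point masses are its right-hand side, so comparison on singletons extends it to all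
      sets.\<close>
    let ?K = "?M \<oplus>\<^sub>m scale_measure (ennreal (A * C ^ u)) (EGD ?F)"
    have K: "emeasure ?K S = emeasure ?M S + ennreal (A * C ^ u) * emeasure (EGD ?F) S" for S
      by (subst emeasure_plus_m) simp_all
    have "emeasure (EGD (Qu u, \<beta>)) S \<le> emeasure ?K S"
      by (rule emeasure_mono_singletons)
        (simp_all only: sets_EGD sets_plus_m K M(2) emeasure_EGD_singleton Qu(4))
    then show ?thesis
      using AC unfolding K by (simp add: em fin flip: ennreal_mult ennreal_plus)
  qed
  have C0: "(\<lambda>u. A * C ^ u * c) \<longlonglongrightarrow> 0" for c
    using AC by (auto intro!: tendsto_mult_left_zero tendsto_mult_right_zero LIMSEQ_power_zero)
  have "(\<lambda>u. tv_dist (EGD (Qu u, \<beta>)) ?M) \<longlonglongrightarrow> 0"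
  proof (rule tendsto_sandwich[OF _ _ tendsto_const C0[of "measure (EGD ?F) UNIV"]])
    have bound: "\<bar>measure (EGD (Qu u, \<beta>)) S - measure ?M S\<bar> \<le> A * C ^ u * measure (EGD ?F) UNIV" for u S
    proof -
      have "measure (EGD ?F) S \<le> measure (EGD ?F) UNIV"
        using fin(3) by (intro finite_measure.finite_measure_mono) auto
      then have "A * C ^ u * measure (EGD ?F) S \<le> A * C ^ u * measure (EGD ?F) UNIV"
        using AC by (intro mult_left_mono) auto
      then show ?thesis
        using meas_low[of S u] meas_upp[of u S] by linarith
    qed
    then show "\<forall>\<^sub>F u in sequentially. tv_dist (EGD (Qu u, \<beta>)) ?M \<le> A * C ^ u * measure (EGD ?F) UNIV"
      unfolding tv_dist_def by (intro always_eventually allI cSUP_least) auto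
    \<comment> \<open>A real supremum is meaningful only for a bounded family, and the bound just
      shown provides this.\<close>
    have "0 \<le> tv_dist (EGD (Qu u, \<beta>)) ?M" for u
      unfolding tv_dist_def using bound
      by (intro cSUP_upper2[of _ _ UNIV]) (auto intro!: bdd_aboveI)
    then show "\<forall>\<^sub>F u in sequentially. 0 \<le> tv_dist (EGD (Qu u, \<beta>)) ?M"
      by simp
  qed
  moreover have "(\<lambda>u. expect (EGD (Qu u, \<beta>)) (\<lambda>x. real (x i) ^ k))
         \<longlonglongrightarrow> expect ?M (\<lambda>x. real (x i) ^ k)" for i k
  proof -
    let ?w = "\<lambda>x. real (x i) ^ k"
    let ?e = "\<Sum>\<^sub>\<infinity>x. egd_mass ?F x * ?w x"
    \<comment> \<open>\<open>infsum\<close> returns 0 on families that are not summable, so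
      summability has to be settled before expectations are compared.\<close>
    have sumF: "(\<lambda>x. egd_mass ?F x * ?w x) summable_on UNIV"
      by (rule summable_on_egd_moment) (rule assms)
    have sumQ: "(\<lambda>x. egd_mass (Qu u, \<beta>) x * ?w x) summable_on UNIV" for u
      by (rule summable_on_egd_moment) (rule Qu)
    have sump: "(\<lambda>x. p x * ?w x) summable_on UNIV"
      using low[of _ 0] p(2) by (intro summable_on_comparison_test[OF sumQ[of 0]] mult_right_mono) auto
    have lo: "expect ?M ?w \<le> expect (EGD (Qu u, \<beta>)) ?w" for u
      unfolding expect_def mass p_def[symmetric]
      using low by (intro infsum_mono sump sumQ mult_right_mono) auto
    have hi: "expect (EGD (Qu u, \<beta>)) ?w \<le> expect ?M ?w + A * C ^ u * ?e" for u
    proof -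
      have "expect (EGD (Qu u, \<beta>)) ?w \<le> (\<Sum>\<^sub>\<infinity>x. p x * ?w x + A * C ^ u * (egd_mass ?F x * ?w x))"
        unfolding expect_def mass
      proof (intro infsum_mono sumQ summable_on_add sump summable_on_cmult_right sumF)
        show "egd_mass (Qu u, \<beta>) x * ?w x \<le> p x * ?w x + A * C ^ u * (egd_mass ?F x * ?w x)" for x
          using mult_right_mono[OF upp[of u x], of "?w x"] by (simp add: distrib_right mult.assoc)
      qed
      also have "\<dots> = expect ?M ?w + A * C ^ u * ?e"
        unfolding expect_def p_def[symmetric]
        by (simp add: infsum_add[OF sump summable_on_cmult_right[OF sumF]] infsum_cmult_right')
      finally show ?thesis .
    qed
    show ?thesis
    proof (rule tendsto_sandwich[OF _ _ tendsto_const])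
      show "\<forall>\<^sub>F u in sequentially. expect ?M ?w \<le> expect (EGD (Qu u, \<beta>)) ?w"
        "\<forall>\<^sub>F u in sequentially. expect (EGD (Qu u, \<beta>)) ?w \<le> expect ?M ?w + A * C ^ u * ?e"
        by (intro always_eventually allI lo hi)+
      show "(\<lambda>u. expect ?M ?w + A * C ^ u * ?e) \<longlonglongrightarrow> expect ?M ?w"
        using tendsto_add[OF tendsto_const C0] by simp
    qed
  qed
  ultimately show ?thesis
    using AC Qu(1-3) meas_upp
    by (intro exI[of _ A] exI[of _ C] exI[of _ Qu] conjI allI) (auto simp: diff_le_eq add.commute)
qed

end
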